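(* Consider the linear system $$\dot x(t)=Ax(t)+Bu(t-\tau),\quad x(t)\in\mathbb{R}^n,\ u(t)\in\mathbb{R}^m,$$ where $\tau>0$, $A\in\mathbb{R}^{n\times n}$, $B\in\mathbb{R}^{n\times m}$. Let $k\in\mathbb{R}^{m\times n}$ be such that $A+Bk$ is Hurwitz. For every $r>0$ there exists an integer $N^*(r)\ge 1$ such that for every integer $N\ge N^*(r)$ there exist constants $Q,\sigma>0$ with the following property: for every partition $\{T_i\}_{i=0}^\infty$ of $\mathbb{R}_+$ with $\sup_{i\ge0}(T_{i+1}-T_i)\le r$, the solution of the closed-loop system consisting of the linear system $\dot x(t)=Ax(t)+Bu(t-\tau)$ together with, for each $i\in\{0,1,2,\dots\}$, $$\dot z(t)=(A+Bk)z(t),\quad u(t)=kz(t),\qquad t\in[T_i,T_{i+1}),\ z(t)\in\mathbb{R}^n,$$ $$z(T_i)=\Big(I+\frac{\tau}{N}A\Big)^N x(T_i)+\sum_{j=0}^{N-1}\Big(I+\frac{\tau}{N}A\Big)^{N-1-j}B\int_{j\frac{\tau}{N}}^{(j+1)\frac{\tau}{N}}u(T_i-\tau+s)\,ds,$$ and arbitrary initial condition $x(0)=x_0\in\mathbb{R}^n$, $u(s)=u_0(s)$ for $s\in[-\tau,0)$ with $u_0\in L^\infty([-\tau,0);\mathbb{R}^m)$, satisfies $$|x(t)|+\sup_{t-\tau\le s<t}|u(s)|\le Q\exp(-\sigma t)\Big(|x_0|+\sup_{-\tau\le s<0}|u_0(s)|\Big),\qquad\forall t\ge0.$$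
   Context: $\mathbb{R}_+=[0,+\infty)$; $|\cdot|$ is the Euclidean norm; $I$ is the identity matrix. A square matrix is Hurwitz if all its eigenvalues have negative real part. A partition $\{T_i\}_{i=0}^\infty$ of $\mathbb{R}_+$ is an increasing sequence of times with $T_0=0$ and $T_i\to+\infty$. $L^\infty([-\tau,0);\mathbb{R}^m)$ is the space of measurable and bounded functions on $[-\tau,0)$ with values in $\mathbb{R}^m$; functions differing on a null set are not identified and $\sup$ denotes the actual supremum. The solution of the closed-loop system is understood as follows: $x$ is absolutely continuous on bounded intervals and satisfies its differential equation $\dot x(t)=Ax(t)+Bu(t-\tau)$ almost everywhere; on each interval $[T_i,T_{i+1})$ the function $z$ solves its differential equation $\dot z(t)=(A+Bk)z(t)$ starting from the value $z(T_i)=\big(I+\frac{\tau}{N}A\big)^N x(T_i)+\sum_{j=0}^{N-1}\big(I+\frac{\tau}{N}A\big)^{N-1-j}B\int_{j\frac{\tau}{N}}^{(j+1)\frac{\tau}{N}}u(T_i-\tau+s)\,ds$ (so $z$ may jump at the times $T_i$), and $u(t)=kz(t)$ for $t\ge 0$. *)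

theory Defs
  imports "HOL-Analysis.Analysis"
begin

definition hurwitz :: "real^'n^'n \<Rightarrow> bool" where
  "hurwitz M \<longleftrightarrow>
     (\<forall>\<mu>::complex. (\<exists>v. v \<noteq> 0 \<and> map_matrix complex_of_real M *v v = \<mu> *s v) \<longrightarrow> Re \<mu> < 0)"

text \<open>The library's power on \<^typ>\<open>real^'n^'n\<close> is taken entrywise, so powers with respect to the
  matrix product need their own definition.\<close>

primrec matrix_power :: "real^'n^'n \<Rightarrow> nat \<Rightarrow> real^'n^'n" where
  "matrix_power M 0 = mat 1"
| "matrix_power M (Suc p) = M ** matrix_power M p"

definition absolutely_continuous_on :: "real set \<Rightarrow> (real \<Rightarrow> 'a::real_normed_vector) \<Rightarrow> bool" where
  "absolutely_continuous_on S f \<longleftrightarrow>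
     (\<forall>\<epsilon>>0. \<exists>\<delta>>0. \<forall>(p::nat) a b.
        (\<forall>i<p. a i \<le> b i \<and> {a i..b i} \<subseteq> S) \<longrightarrow>
        disjoint_family_on (\<lambda>i. {a i<..<b i}) {..<p} \<longrightarrow>
        (\<Sum>i<p. b i - a i) < \<delta> \<longrightarrow>
        (\<Sum>i<p. norm (f (b i) - f (a i))) < \<epsilon>)"

definition time_partition :: "(nat \<Rightarrow> real) \<Rightarrow> bool" where
  "time_partition T \<longleftrightarrow> strict_mono T \<and> T 0 = 0 \<and> filterlim T at_top sequentially"

text \<open>\<^const>\<open>bdd_above\<close> is stated because \<^const>\<open>Sup\<close> on the reals is unspecified for
  unbounded sets.\<close>

definition mesh_le :: "(nat \<Rightarrow> real) \<Rightarrow> real \<Rightarrow> bool" where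
  "mesh_le T r \<longleftrightarrow>
     bdd_above (range (\<lambda>i. T (Suc i) - T i)) \<and> (SUP i. T (Suc i) - T i) \<le> r"

text \<open>Genuine functions, not classes modulo null sets.\<close>

definition L_infinity_on :: "real set \<Rightarrow> (real \<Rightarrow> 'a::real_normed_vector) \<Rightarrow> bool" where
  "L_infinity_on S f \<longleftrightarrow> f \<in> borel_measurable (lebesgue_on S) \<and> bounded (f ` S)"

text \<open>The approximate prediction of \<open>x (t + \<tau>)\<close> from \<open>\<xi> = x t\<close> and the past input on \<open>[t - \<tau>, t)\<close>:
  \<open>N\<close> steps of length \<open>\<tau>/N\<close>, each replacing \<open>exp ((\<tau>/N) A)\<close> by \<open>I + (\<tau>/N) A\<close>.
  The integrals are Henstock-Kurzweil integrals; they agree with the Lebesgue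
  integrals, the integrands being bounded and measurable.\<close>

definition approx_predictor ::
  "real^'n^'n \<Rightarrow> real^'m^'n \<Rightarrow> real \<Rightarrow> nat \<Rightarrow> real^'n \<Rightarrow> (real \<Rightarrow> real^'m) \<Rightarrow> real \<Rightarrow> real^'n" where
  "approx_predictor A B \<tau> N \<xi> u t =
     matrix_power (mat 1 + (\<tau> / real N) *\<^sub>R A) N *v \<xi>
     + (\<Sum>j<N. (matrix_power (mat 1 + (\<tau> / real N) *\<^sub>R A) (N - 1 - j) ** B)
           *v integral {real j * (\<tau> / real N)..real (j + 1) * (\<tau> / real N)} (\<lambda>s. u (t - \<tau> + s)))"

text \<open>Only the values of \<open>x\<close> and \<open>z\<close> on \<open>[0, \<infinity>)\<close>, of \<open>u\<close> on \<open>[-\<tau>, \<infinity>)\<close> and of \<open>u0\<close> on \<open>[-\<tau>, 0)\<close>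
  matter. The derivative of \<open>z\<close> at \<open>T i\<close> is one-sided, so \<open>z\<close> may jump there.\<close>

definition closed_loop_solution ::
  "real^'n^'n \<Rightarrow> real^'m^'n \<Rightarrow> real^'n^'m \<Rightarrow> real \<Rightarrow> nat \<Rightarrow> (nat \<Rightarrow> real) \<Rightarrow> real^'n \<Rightarrow> (real \<Rightarrow> real^'m)
   \<Rightarrow> (real \<Rightarrow> real^'n) \<Rightarrow> (real \<Rightarrow> real^'n) \<Rightarrow> (real \<Rightarrow> real^'m) \<Rightarrow> bool" where
  "closed_loop_solution A B k \<tau> N T x0 u0 x z u \<longleftrightarrow>
     x 0 = x0 \<and>
     (\<forall>s\<in>{-\<tau>..<0}. u s = u0 s) \<and>
     (\<forall>b>0. absolutely_continuous_on {0..b} x) \<and>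
     (AE t in lebesgue. 0 \<le> t \<longrightarrow>
        (x has_vector_derivative (A *v x t + B *v u (t - \<tau>))) (at t)) \<and>
     (\<forall>i. z (T i) = approx_predictor A B \<tau> N (x (T i)) u (T i)) \<and>
     (\<forall>i. \<forall>t\<in>{T i..<T (Suc i)}.
        (z has_vector_derivative ((A + B ** k) *v z t)) (at t within {T i..<T (Suc i)})) \<and>
     (\<forall>t\<ge>0. u t = k *v z t)"

end

(* Let p t = x (t + tau) be the true future state and e = z - p the prediction error. For t >= 0,
   p' = (A + B k) p + B k e, while e' = A e between sampling times. At a sampling time, e is the error
   of N Euler steps, at most C/N times the norms of x and of the past input. Since A + B k is Hurwitz,
   an error of size eta exp(-sigma t) keeps p of size exp(-sigma t), and for large N the sampling
   errors computed from such p and e are again below eta exp(-sigma t); this closes an induction over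
   the sampling intervals. Exponential decay for a Hurwitz matrix M is obtained without a matrix
   exponential: a product of factors M - mu_j I over eigenvalues mu_j vanishes, and peeling off one
   factor at a time reduces to scalar equations. *)

theory Submission
  imports Defs "HOL-Computational_Algebra.Fundamental_Theorem_Algebra"
begin

section \<open>Calculus for absolutely continuous functions\<close>

text \<open>A single rate \<sigma> survives the whole loop because it keeps a strict margin, Re
  \<mu> < - \<sigma> for each eigenvalue \<mu> used: a forcing of size exp (- \<sigma> t) is then
  not resonant and produces a response of the same size. The mutual dependence of e and u is
  resolved by causality: z (T i) involves only x (T i) and the input before T i, both already
  controlled by the error before T i. Hence the error bounds are assumed on half-open intervals. The
  constant \<eta> is fixed first, from the gain with which e drives p. What depends on r, namely the
  growth of e between samples and the decay lost meanwhile, is compensated afterwards by N alone, so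
  Q and \<sigma> depend neither on r nor on N. Since x satisfies its equation only almost
  everywhere, all estimates start from integral identities; a derivative is recovered only for p,
  away from the sampling times.\<close>

lemma absolutely_continuous_on_finite_family:
  fixes f :: "real \<Rightarrow> 'a::real_normed_vector"
  assumes "absolutely_continuous_on S f" "e > 0"
  shows "\<exists>d>0. \<forall>(I::'b set) l u. finite I \<longrightarrow> (\<forall>i\<in>I. l i \<le> u i \<and> {l i..u i} \<subseteq> S) \<longrightarrow>
    disjoint_family_on (\<lambda>i. {l i<..<u i}) I \<longrightarrow> (\<Sum>i\<in>I. u i - l i) < d \<longrightarrow>
    (\<Sum>i\<in>I. norm (f (u i) - f (l i))) < e"
proof -
  obtain d where "d > 0" and d: "\<And>(p::nat) a b. \<lbrakk>\<forall>i<p. a i \<le> b i \<and> {a i..b i} \<subseteq> S;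
       disjoint_family_on (\<lambda>i. {a i<..<b i}) {..<p}; (\<Sum>i<p. b i - a i) < d\<rbrakk>
       \<Longrightarrow> (\<Sum>i<p. norm (f (b i) - f (a i))) < e"
    using assms unfolding absolutely_continuous_on_def by meson
  show ?thesis
  proof (intro exI[of _ d] conjI allI impI \<open>d > 0\<close>)
    fix I :: "'b set" and l u
    assume fin: "finite I" and lu: "\<forall>i\<in>I. l i \<le> u i \<and> {l i..u i} \<subseteq> S"
      and disj: "disjoint_family_on (\<lambda>i. {l i<..<u i}) I" and less: "(\<Sum>i\<in>I. u i - l i) < d"
    \<comment> \<open>Tagged divisions are sets of pairs, whereas the definition numbers its
      intervals; a bijection carries the bound over.\<close>
    obtain h where h: "bij_betw h {..<card I} I"
      using ex_bij_betw_nat_finite[OF fin] by (auto simp: lessThan_atLeast0)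
    have hI: "h i \<in> I" if "i < card I" for i
      using h that by (auto simp: bij_betw_def)
    have "(\<Sum>i<card I. norm (f (u (h i)) - f (l (h i)))) < e"
    proof (rule d)
      show "\<forall>i<card I. l (h i) \<le> u (h i) \<and> {l (h i)..u (h i)} \<subseteq> S"
        using lu hI by blast
      show "disjoint_family_on (\<lambda>i. {l (h i)<..<u (h i)}) {..<card I}"
        unfolding disjoint_family_on_def
      proof (intro ballI impI)
        fix i j assume ij: "i \<in> {..<card I}" "j \<in> {..<card I}" "i \<noteq> j"
        then have "h i \<noteq> h j" using h by (auto simp: bij_betw_def inj_on_def)
        then show "{l (h i)<..<u (h i)} \<inter> {l (h j)<..<u (h j)} = {}"
          using disj hI ij unfolding disjoint_family_on_def by (meson lessThan_iff)
      qed
      show "(\<Sum>i<card I. u (h i) - l (h i)) < d"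
        using less sum.reindex_bij_betw[OF h, of "\<lambda>i. u i - l i"] by simp
    qed
    then show "(\<Sum>i\<in>I. norm (f (u i) - f (l i))) < e"
      using sum.reindex_bij_betw[OF h, of "\<lambda>i. norm (f (u i) - f (l i))"] by simp
  qed
qed

lemma absolutely_continuous_on_imp_continuous_on:
  fixes f :: "real \<Rightarrow> 'a::real_normed_vector"
  assumes "absolutely_continuous_on {a..b} f"
  shows "continuous_on {a..b} f"
  unfolding continuous_on_iff
proof (intro ballI allI impI)
  fix x and e :: real
  assume x: "x \<in> {a..b}" and "e > 0"
  obtain d where "d > 0"
    and d: "\<forall>(I::unit set) l u. finite I \<longrightarrow>
       (\<forall>i\<in>I. l i \<le> u i \<and> {l i..u i} \<subseteq> {a..b}) \<longrightarrow>
       disjoint_family_on (\<lambda>i. {l i<..<u i}) I \<longrightarrow> (\<Sum>i\<in>I. u i - l i) < d \<longrightarrow>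
       (\<Sum>i\<in>I. norm (f (u i) - f (l i))) < e"
      using absolutely_continuous_on_finite_family[OF assms \<open>e > 0\<close>, where 'b = unit]
      by (elim exE conjE) (rule that)
  have "dist (f y) (f x) < e" if y: "y \<in> {a..b}" "dist y x < d" for y
    using d[rule_format, of UNIV "\<lambda>_. min x y" "\<lambda>_. max x y"] x y
    by (auto simp: disjoint_family_on_def dist_norm norm_minus_commute min_def max_def abs_if split: if_splits)
  then show "\<exists>d>0. \<forall>x'\<in>{a..b}. dist x' x < d \<longrightarrow> dist (f x') (f x) < e"
    using \<open>d > 0\<close> by blast
qed

text \<open>Intervals tagged in \<open>N\<close> lie in an open set of small measure, so absolute continuity makes their
  total increment small; the other tags are treated as in the usual fundamental theorem.\<close>

lemma has_integral_derivative_absolutely_continuous: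
  fixes f :: "real \<Rightarrow> 'a::banach"
  assumes "a \<le> b" and ac: "absolutely_continuous_on {a..b} f" and N: "negligible N"
    and deriv: "\<And>t. t \<in> {a..b} - N \<Longrightarrow> (f has_vector_derivative g t) (at t within {a..b})"
  shows "(g has_integral f b - f a) {a..b}"
proof -
  \<comment> \<open>With value 0 on N, intervals tagged there contribute only the increments of f,
    which absolute continuity controls.\<close>
  define g' where "g' t = (if t \<in> N then 0 else g t)" for t
  have "(g' has_integral f b - f a) {a..b}"
    unfolding has_integral_real
  proof (intro allI impI)
    fix e :: real
    assume "e > 0"
    \<comment> \<open>Half of the tolerance is spread over the length of the interval; the summand 1
      covers a = b.\<close>
    define e1 where "e1 = e / (2 * (b - a + 1))"
    have "e1 > 0" and e1: "e1 * (b - a) \<le> e / 2"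
      using \<open>e > 0\<close> \<open>a \<le> b\<close> by (auto simp: e1_def field_simps)
    obtain \<delta> where "\<delta> > 0" and \<delta>: "\<forall>(I::(real \<times> real set) set) l u. finite I \<longrightarrow>
       (\<forall>i\<in>I. l i \<le> u i \<and> {l i..u i} \<subseteq> {a..b}) \<longrightarrow>
       disjoint_family_on (\<lambda>i. {l i<..<u i}) I \<longrightarrow> (\<Sum>i\<in>I. u i - l i) < \<delta> \<longrightarrow>
       (\<Sum>i\<in>I. norm (f (u i) - f (l i))) < e / 2"
      using absolutely_continuous_on_finite_family[OF ac half_gt_zero[OF \<open>e > 0\<close>], where 'b = "real \<times> real set"]
      by (elim exE conjE) (rule that)
    obtain U where "open U" "N \<subseteq> U" and Um: "U \<in> lmeasurable" "measure lebesgue U < \<delta>"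
    proof -
      obtain U where U: "open U" "N \<subseteq> U" "U - N \<in> lmeasurable" "emeasure lebesgue (U - N) < ennreal \<delta>"
        using sets_lebesgue_outer_open[OF negligible_imp_sets[OF N] \<open>\<delta> > 0\<close>] .
      have "U = (U - N) \<union> N" using \<open>N \<subseteq> U\<close> by auto
      then have m: "U \<in> lmeasurable"
        using U(3) negligible_imp_measurable[OF N] by (metis fmeasurable.Un)
      have "measure lebesgue U = measure lebesgue (U - N)"
        using N by (metis measure_Diff_null_set m fmeasurableD negligible_iff_null_sets)
      also have "\<dots> < \<delta>"
        using U(3,4) \<open>\<delta> > 0\<close> by (simp add: emeasure_eq_measure2 ennreal_less_iff)
      finally show thesis using that U m by blast
    qed
    have "\<exists>d>0. t \<in> {a..b} - N \<longrightarrow> (\<forall>y\<in>{a..b}. norm (y-t) < d \<longrightarrow>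
         norm (f y - f t - (y-t) *\<^sub>R g t) \<le> e1 * norm (y-t))" for t
      using deriv[of t] \<open>e1 > 0\<close> unfolding has_vector_derivative_def has_derivative_within_alt
      by (cases "t \<in> {a..b} - N") (auto intro: exI[of _ 1])
    then obtain d where d: "\<And>t. 0 < d t"
        "\<And>t y. \<lbrakk>t \<in> {a..b} - N; y \<in> {a..b}; norm (y-t) < d t\<rbrakk>
           \<Longrightarrow> norm (f y - f t - (y-t) *\<^sub>R g t) \<le> e1 * norm (y-t)"
      by metis
    define \<gamma> where "\<gamma> t = (if t \<in> N then U else ball t (d t))" for t
    show "\<exists>\<gamma>. gauge \<gamma> \<and> (\<forall>p. p tagged_division_of {a..b} \<and> \<gamma> fine p \<longrightarrow>
           norm ((\<Sum>(x, K)\<in>p. measure lborel K *\<^sub>R g' x) - (f b - f a)) < e)"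
    proof (intro exI[of _ \<gamma>] conjI allI impI)
      show "gauge \<gamma>"
        using \<open>open U\<close> \<open>N \<subseteq> U\<close> d(1) by (auto simp: gauge_def \<gamma>_def)
    next
      fix p
      assume "p tagged_division_of {a..b} \<and> \<gamma> fine p"
      then have ptag: "p tagged_division_of {a..b}" and fine: "\<gamma> fine p" by auto
      have finp: "finite p" using ptag by blast
      define P where "P = {q \<in> p. fst q \<in> N}"
      define r where "r q = measure lborel (snd q) *\<^sub>R g' (fst q) - (f (Sup (snd q)) - f (Inf (snd q)))" for q :: "real \<times> real set"
      have itv: "K = {Inf K..Sup K} \<and> Inf K \<le> x \<and> x \<le> Sup K \<and> a \<le> Inf K \<and> Sup K \<le> b
          \<and> measure lborel K = Sup K - Inf K" if "(x, K) \<in> p" for x K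
      proof -
        obtain u v where K: "K = {u..v}" using ptag \<open>(x, K) \<in> p\<close>
          by (metis box_real(2) tagged_division_ofD(4))
        moreover have "x \<in> K" "K \<subseteq> {a..b}" using ptag that by blast+
        ultimately have "u \<le> v" "Inf K = u" "Sup K = v" by (auto simp: cInf_eq_minimum cSup_eq_maximum)
        then show ?thesis using K \<open>x \<in> K\<close> \<open>K \<subseteq> {a..b}\<close> by simp
      qed
      have ord: "Inf (snd q) \<le> Sup (snd q)" "a \<le> Inf (snd q)" "Sup (snd q) \<le> b" if "q \<in> p" for q
        using itv[of "fst q" "snd q"] that by auto
      have eqs: "(\<Sum>q\<in>p. Sup (snd q) - Inf (snd q)) = b - a"
          "(\<Sum>q\<in>p. f (Sup (snd q)) - f (Inf (snd q))) = f b - f a"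
        using additive_tagged_division_1[OF \<open>a \<le> b\<close> ptag, of "\<lambda>x. x"]
          additive_tagged_division_1[OF \<open>a \<le> b\<close> ptag, of f] by (simp_all add: case_prod_unfold)
      have good: "norm (r q) \<le> e1 * (Sup (snd q) - Inf (snd q))" if q: "q \<in> p - P" for q
      proof -
        obtain x K where qx: "q = (x, K)" by force
        with q have xK: "(x, K) \<in> p" "x \<notin> N" by (auto simp: P_def)
        note i = itv[OF xK(1)]
        then have c: "measure lborel K = Sup K - Inf K" by blast
        have sub: "K \<subseteq> ball x (d x)" using fineD[OF fine xK(1)] xK by (simp add: \<gamma>_def)
        have xab: "x \<in> {a..b} - N" using i xK by auto
        have lo: "norm (f (Inf K) - f x - (Inf K - x) *\<^sub>R g x) \<le> e1 * norm (Inf K - x)"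
          and hi: "norm (f (Sup K) - f x - (Sup K - x) *\<^sub>R g x) \<le> e1 * norm (Sup K - x)"
        proof -
          have "Inf K \<in> ball x (d x)" "Sup K \<in> ball x (d x)" using i sub by force+
          then show "norm (f (Inf K) - f x - (Inf K - x) *\<^sub>R g x) \<le> e1 * norm (Inf K - x)"
            "norm (f (Sup K) - f x - (Sup K - x) *\<^sub>R g x) \<le> e1 * norm (Sup K - x)"
            using i d(2)[OF xab, of "Inf K"] d(2)[OF xab, of "Sup K"] by (simp_all add: dist_real_def)
        qed
        \<comment> \<open>Straddle estimate: the tag lies between the endpoints, so the two
          one-sided errors add up to e1 times the length of the interval.\<close>
        have "r q = (f (Inf K) - f x - (Inf K - x) *\<^sub>R g x) - (f (Sup K) - f x - (Sup K - x) *\<^sub>R g x)"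
          using xK by (simp add: r_def qx g'_def c scaleR_diff_left)
        then have "norm (r q) \<le> e1 * norm (Inf K - x) + e1 * norm (Sup K - x)"
          using lo hi norm_triangle_ineq4 by (smt (verit))
        also have "\<dots> = e1 * (Sup K - Inf K)" using i by (simp add: algebra_simps)
        finally show ?thesis by (simp add: qx)
      qed
      have "P \<subseteq> p" "finite P" using finp by (auto simp: P_def)
      have disj: "disjoint_family_on (\<lambda>q. {Inf (snd q)<..<Sup (snd q)}) P"
        unfolding disjoint_family_on_def
      proof (intro ballI impI)
        fix q q' assume q: "q \<in> P" "q' \<in> P" "q \<noteq> q'"
        then have "interior (snd q) \<inter> interior (snd q') = {}"
          using tagged_division_ofD(5)[OF ptag, of "fst q" "snd q" "fst q'" "snd q'"] \<open>P \<subseteq> p\<close> by auto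
        moreover have "{Inf (snd q)<..<Sup (snd q)} = interior (snd q)" if "q \<in> P" for q
          using itv[of "fst q" "snd q"] that \<open>P \<subseteq> p\<close>
          by (metis interior_atLeastAtMost_real prod.collapse subsetD)
        ultimately show "{Inf (snd q)<..<Sup (snd q)} \<inter> {Inf (snd q')<..<Sup (snd q')} = {}"
          using q by simp
      qed
      have "(\<Sum>q\<in>P. Sup (snd q) - Inf (snd q)) = (\<Sum>q\<in>P. measure lebesgue {Inf (snd q)<..<Sup (snd q)})"
        using ord \<open>P \<subseteq> p\<close> by (intro sum.cong) (auto simp: subset_eq)
      also have "\<dots> = measure lebesgue (\<Union>q\<in>P. {Inf (snd q)<..<Sup (snd q)})"
        using \<open>finite P\<close> disj
        by (intro measure_UNION'[symmetric]) (auto simp: pairwise_def disjoint_family_on_def disjnt_def)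
      also have "\<dots> \<le> measure lebesgue U"
      proof (rule measure_mono_fmeasurable[OF _ _ Um(1)])
        have "{Inf K<..<Sup K} \<subseteq> U" if "(x, K) \<in> P" for x K
        proof -
          have "(x, K) \<in> p" "x \<in> N" using that by (auto simp: P_def)
          then have "K \<subseteq> U" using fineD[OF fine, of x K] by (simp add: \<gamma>_def)
          then show ?thesis using itv[OF \<open>(x, K) \<in> p\<close>] by (metis greaterThanLessThan_subseteq_atLeastAtMost_iff order_refl order_trans)
        qed
        then show "(\<Union>q\<in>P. {Inf (snd q)<..<Sup (snd q)}) \<subseteq> U" by (intro UN_least) (metis prod.collapse)
        show "(\<Union>q\<in>P. {Inf (snd q)<..<Sup (snd q)}) \<in> sets lebesgue"
          using \<open>finite P\<close> by (intro sets.finite_UN) auto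
      qed
      also have "\<dots> < \<delta>" by (rule Um(2))
      finally have less: "(\<Sum>q\<in>P. Sup (snd q) - Inf (snd q)) < \<delta>" .
      have "Inf (snd q) \<le> Sup (snd q) \<and> {Inf (snd q)..Sup (snd q)} \<subseteq> {a..b}" if "q \<in> P" for q
        using ord[OF subsetD[OF \<open>P \<subseteq> p\<close> that]] by simp
      then have bad: "(\<Sum>q\<in>P. norm (f (Sup (snd q)) - f (Inf (snd q)))) < e / 2"
        using less by (intro \<delta>[rule_format, OF \<open>finite P\<close> _ disj]) blast+
      have "(\<Sum>(x, K)\<in>p. measure lborel K *\<^sub>R g' x) - (f b - f a) = (\<Sum>q\<in>p. r q)"
        by (simp add: r_def case_prod_unfold flip: eqs(2) sum_subtractf)
      also have "\<dots> = (\<Sum>q\<in>p - P. r q) + (\<Sum>q\<in>P. r q)"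
        using \<open>P \<subseteq> p\<close> finp by (rule sum.subset_diff)
      finally have "norm ((\<Sum>(x, K)\<in>p. measure lborel K *\<^sub>R g' x) - (f b - f a))
          \<le> norm (\<Sum>q\<in>p - P. r q) + norm (\<Sum>q\<in>P. r q)" using norm_triangle_ineq by metis
      moreover have "norm (\<Sum>q\<in>p - P. r q) \<le> (\<Sum>q\<in>p. e1 * (Sup (snd q) - Inf (snd q)))"
      proof (rule order_trans[OF sum_norm_le[OF good]])
        show "(\<Sum>q\<in>p - P. e1 * (Sup (snd q) - Inf (snd q))) \<le> (\<Sum>q\<in>p. e1 * (Sup (snd q) - Inf (snd q)))"
          using finp ord \<open>e1 > 0\<close> by (intro sum_mono2) auto
      qed
      moreover have "(\<Sum>q\<in>p. e1 * (Sup (snd q) - Inf (snd q))) \<le> e / 2"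
        using e1 eqs(1) by (simp flip: sum_distrib_left)
      moreover have "norm (\<Sum>q\<in>P. r q) \<le> (\<Sum>q\<in>P. norm (f (Sup (snd q)) - f (Inf (snd q))))"
        by (rule sum_norm_le) (auto simp: r_def P_def g'_def norm_minus_commute)
      ultimately show "norm ((\<Sum>(x, K)\<in>p. measure lborel K *\<^sub>R g' x) - (f b - f a)) < e"
        using bad by linarith
    qed
  qed
  then show ?thesis
    by (rule has_integral_spike[OF N, rotated]) (simp add: g'_def)
qed

text \<open>The integral inequality is evaluated where \<open>exp (- 2 \<alpha> s) |y s|\<close> is maximal.\<close>

lemma gronwall_bound:
  fixes y h :: "real \<Rightarrow> 'a::euclidean_space"
  assumes "\<alpha> > 0" "\<beta> \<ge> 0" "a \<le> b"
    and cont: "continuous_on {a..b} y"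
    and int: "\<And>t. t \<in> {a..b} \<Longrightarrow> (h has_integral y t - y a) {a..t}"
    and bound: "\<And>s. s \<in> {a..b} \<Longrightarrow> norm (h s) \<le> \<alpha> * norm (y s) + \<beta>"
    and t: "t \<in> {a..b}"
  shows "norm (y t) \<le> 2 * exp (2 * \<alpha> * (b - a)) * (norm (y a) + \<beta> * (b - a))"
proof -
  define w where "w s = exp (- 2 * \<alpha> * (s - a)) * norm (y s)" for s
  have "continuous_on {a..b} w"
    unfolding w_def by (intro continuous_intros cont)
  then obtain s where s: "s \<in> {a..b}" and max: "\<And>r. r \<in> {a..b} \<Longrightarrow> w r \<le> w s"
    using continuous_attains_sup[of "{a..b}" w] \<open>a \<le> b\<close> by auto
  define m where "m = w s"
  have "m \<ge> 0" by (simp add: m_def w_def)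
  have ym: "norm (y r) \<le> m * exp (2 * \<alpha> * (r - a))" if "r \<in> {a..b}" for r
  proof -
    have "norm (y r) = w r * exp (2 * \<alpha> * (r - a))"
      by (simp add: w_def exp_minus)
    then show ?thesis using mult_right_mono[OF max[OF that]] by (simp add: m_def)
  qed
  \<comment> \<open>The weight grows at twice the rate \<alpha>, so integrating the bound returns
    only half of the exponential term, which the left-hand side absorbs. The price is the factor 2
    in the conclusion.\<close>
  have deriv: "((\<lambda>r. m / 2 * exp (2 * \<alpha> * (r - a)) + \<beta> * r) has_vector_derivative
      \<alpha> * (m * exp (2 * \<alpha> * (r - a))) + \<beta>) (at r within {a..s})" for r
    by (auto intro!: derivative_eq_intros simp flip: has_real_derivative_iff_has_vector_derivative)
  have "((\<lambda>r. \<alpha> * (m * exp (2 * \<alpha> * (r - a))) + \<beta>) has_integral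
      (m / 2 * exp (2 * \<alpha> * (s - a)) + \<beta> * s) - (m / 2 * exp (2 * \<alpha> * (a - a)) + \<beta> * a)) {a..s}"
    using s by (intro fundamental_theorem_of_calculus deriv) auto
  then have I: "((\<lambda>r. \<alpha> * (m * exp (2 * \<alpha> * (r - a))) + \<beta>) has_integral
      m / 2 * (exp (2 * \<alpha> * (s - a)) - 1) + \<beta> * (s - a)) {a..s}"
    by (simp add: algebra_simps)
  have "norm (integral {a..s} h) \<le> integral {a..s} (\<lambda>r. \<alpha> * (m * exp (2 * \<alpha> * (r - a))) + \<beta>)"
  proof (rule integral_norm_bound_integral)
    fix r assume r: "r \<in> {a..s}"
    then have "r \<in> {a..b}" using s by auto
    then show "norm (h r) \<le> \<alpha> * (m * exp (2 * \<alpha> * (r - a))) + \<beta>"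
      using bound[of r] ym[of r] \<open>\<alpha> > 0\<close>
      by (meson add_right_mono less_imp_le mult_left_mono order_trans)
  qed (use int[OF s] I in blast)+
  then have "norm (y s - y a) \<le> m / 2 * (exp (2 * \<alpha> * (s - a)) - 1) + \<beta> * (s - a)"
    using int[OF s] I by (simp add: integral_unique)
  moreover have "\<beta> * (s - a) \<le> \<beta> * (b - a)" using s \<open>\<beta> \<ge> 0\<close> by (intro mult_left_mono) auto
  moreover have "norm (y s) = m * exp (2 * \<alpha> * (s - a))"
    by (simp add: m_def w_def exp_minus)
  ultimately have "m / 2 * exp (2 * \<alpha> * (s - a)) \<le> norm (y a) + \<beta> * (b - a)"
    using norm_triangle_sub[of "y s" "y a"] \<open>m \<ge> 0\<close> by (simp add: algebra_simps)
  moreover have "m / 2 * 1 \<le> m / 2 * exp (2 * \<alpha> * (s - a))"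
    using s \<open>\<alpha> > 0\<close> \<open>m \<ge> 0\<close> by (intro mult_left_mono) auto
  ultimately have "m / 2 * 1 \<le> norm (y a) + \<beta> * (b - a)" by (rule order_trans[rotated])
  then have "m \<le> 2 * (norm (y a) + \<beta> * (b - a))" by simp
  moreover have "exp (2 * \<alpha> * (t - a)) \<le> exp (2 * \<alpha> * (b - a))"
    using t \<open>\<alpha> > 0\<close> by simp
  ultimately have "m * exp (2 * \<alpha> * (t - a)) \<le> 2 * (norm (y a) + \<beta> * (b - a)) * exp (2 * \<alpha> * (b - a))"
    using \<open>m \<ge> 0\<close> by (intro mult_mono) auto
  then have "m * exp (2 * \<alpha> * (t - a)) \<le> 2 * exp (2 * \<alpha> * (b - a)) * (norm (y a) + \<beta> * (b - a))"
    by (simp only: mult_ac)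
  with ym[OF t] show ?thesis by (rule order_trans)
qed

section \<open>Matrix bounds and the explicit Euler scheme\<close>

lemma matrix_norm_bound:
  fixes M :: "real^'n^'m"
  shows "\<exists>c>0. \<forall>v. norm (M *v v) \<le> c * norm v"
  using bounded_linear.pos_bounded[OF matrix_vector_mul_bounded_linear[of M]]
  by (metis mult.commute)

text \<open>Discrete variation of constants: it recognises the sum in
  \<open>approx_predictor\<close> as the N-th iterate of an Euler step.\<close>

lemma matrix_power_recursion:
  fixes E :: "real^'n^'n" and w b :: "nat \<Rightarrow> real^'n"
  assumes "\<And>j. w (Suc j) = E *v w j + b j"
  shows "w p = matrix_power E p *v w 0 + (\<Sum>j<p. matrix_power E (p - 1 - j) *v b j)"
proof (induction p)
  case (Suc p)
  have eq: "matrix_power E (Suc p - 1 - j) *v b j = E *v (matrix_power E (p - 1 - j) *v b j)" if "j < p" for j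
  proof -
    have "Suc p - 1 - j = Suc (p - 1 - j)" using that by simp
    then show ?thesis by (simp add: matrix_vector_mul_assoc)
  qed
  have "w (Suc p) = E *v (matrix_power E p *v w 0 + (\<Sum>j<p. matrix_power E (p - 1 - j) *v b j)) + b p"
    using assms[of p] Suc by simp
  also have "\<dots> = matrix_power E (Suc p) *v w 0 + (\<Sum>j<p. matrix_power E (Suc p - 1 - j) *v b j) + b p"
    using eq by (simp add: matrix_vector_right_distrib matrix_vector_mul_assoc linear_sum[OF matrix_vector_mul_linear])
  finally show ?case by simp
qed simp

text \<open>Local truncation errors of size \<open>h^2\<close> accumulate over \<open>N = \<tau>/h\<close> steps to an error of size
  \<open>h\<close>.\<close>

lemma euler_error:
  fixes A :: "real^'n^'n" and y g :: "real \<Rightarrow> real^'n"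
  assumes "\<alpha> > 0" and A: "\<And>v. norm (A *v v) \<le> \<alpha> * norm v"
    and "\<tau> > 0" "N \<ge> 1" and R: "R \<ge> 0"
    and cont: "continuous_on {0..\<tau>} y"
    and yint: "\<And>c d. \<lbrakk>0 \<le> c; c \<le> d; d \<le> \<tau>\<rbrakk> \<Longrightarrow> ((\<lambda>s. A *v y s + g s) has_integral y d - y c) {c..d}"
    and gint: "\<And>c d. \<lbrakk>0 \<le> c; c \<le> d; d \<le> \<tau>\<rbrakk> \<Longrightarrow> g integrable_on {c..d}"
    and rate: "\<And>s. s \<in> {0..\<tau>} \<Longrightarrow> norm (A *v y s + g s) \<le> R"
  shows "norm (y \<tau> - (matrix_power (mat 1 + (\<tau> / real N) *\<^sub>R A) N *v y 0
     + (\<Sum>j<N. matrix_power (mat 1 + (\<tau> / real N) *\<^sub>R A) (N - 1 - j) *v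
          integral {real j * (\<tau> / real N)..real (j + 1) * (\<tau> / real N)} g)))
     \<le> \<tau>\<^sup>2 * \<alpha> * R * exp (\<alpha> * \<tau>) / real N"
proof -
  define h where "h = \<tau> / real N"
  have h: "h > 0" "real N * h = \<tau>" using assms by (auto simp: h_def)
  define b where "b j = integral {real j * h..real (j + 1) * h} g" for j
  define E where "E = mat 1 + h *\<^sub>R A"
  have E: "E *v v = v + h *\<^sub>R (A *v v)" for v
    by (simp add: E_def matrix_vector_mult_add_rdistrib scaleR_matrix_vector_assoc)
  define w where "w = rec_nat (y 0) (\<lambda>j v. E *v v + b j)"
  have w0: "w 0 = y 0" and wS: "w (Suc j) = E *v w j + b j" for j
    by (simp_all add: w_def)
  have wN: "w N = matrix_power E N *v y 0 + (\<Sum>j<N. matrix_power E (N - 1 - j) *v b j)"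
    using matrix_power_recursion[of w E b N] wS w0 by simp
  define q where "q = 1 + h * \<alpha>"
  have q: "q \<ge> 1" using h \<open>\<alpha> > 0\<close> by (simp add: q_def)
  have qexp: "q ^ j \<le> exp (\<alpha> * \<tau>)" if "j \<le> N" for j
  proof -
    have "q ^ j \<le> exp (h * \<alpha>) ^ j" unfolding q_def using h \<open>\<alpha> > 0\<close>
      by (intro power_mono) auto
    also have "\<dots> = exp (\<alpha> * (real j * h))" by (simp add: exp_of_nat_mult[symmetric] mult_ac)
    also have "\<dots> \<le> exp (\<alpha> * \<tau>)"
      using that h \<open>\<alpha> > 0\<close> by (simp flip: h(2))
    finally show ?thesis .
  qed
  have step: "norm (y (real (Suc j) * h) - w (Suc j)) \<le> q * norm (y (real j * h) - w j) + h\<^sup>2 * \<alpha> * R"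
    if "j < N" for j
  proof -
    define c d where "c = real j * h" and "d = real (Suc j) * h"
    have cd: "0 \<le> c" "c \<le> d" "d \<le> \<tau>" "d - c = h"
    proof -
      have "real (Suc j) * h \<le> real N * h" using that h by (intro mult_right_mono) auto
      then show "d \<le> \<tau>" using h by (simp add: d_def)
    qed (use h in \<open>auto simp: c_def d_def algebra_simps\<close>)
    have near: "norm (y s - y c) \<le> h * R" if "s \<in> {c..d}" for s
    proof -
      have "norm (integral {c..s} (\<lambda>s. A *v y s + g s)) \<le> integral {c..s} (\<lambda>_. R)"
        using yint[of c s] cd that by (intro integral_norm_bound_integral rate) auto
      then have "norm (y s - y c) \<le> (s - c) * R"
        using yint[of c s] cd that by (simp add: integral_unique)
      also have "\<dots> \<le> h * R" using that cd R by (intro mult_right_mono) auto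
      finally show ?thesis .
    qed
    have i1: "((\<lambda>s. A *v y s + g s) has_integral y d - y c) {c..d}" using yint cd by blast
    have i2: "(g has_integral b j) {c..d}"
      using gint[of c d] cd by (auto simp: b_def c_def d_def add.commute)
    have i3: "((\<lambda>s. A *v y c) has_integral h *\<^sub>R (A *v y c)) {c..d}"
      using has_integral_const_real[of "A *v y c" c d] cd by simp
    \<comment> \<open>The forcing is integrated exactly within each step, so the local error comes
      only from freezing \<open>A *v y s\<close> at the left endpoint.\<close>
    have i4: "((\<lambda>s. A *v (y s - y c)) has_integral y d - y c - b j - h *\<^sub>R (A *v y c)) {c..d}"
      using has_integral_diff[OF has_integral_diff[OF i1 i2] i3] by (simp add: matrix_vector_mult_diff_distrib)
    have "norm (integral {c..d} (\<lambda>s. A *v (y s - y c))) \<le> integral {c..d} (\<lambda>_. \<alpha> * (h * R))"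
      using i4 \<open>\<alpha> > 0\<close> by (intro integral_norm_bound_integral order_trans[OF A] mult_left_mono near) auto
    then have loc: "norm (y d - y c - b j - h *\<^sub>R (A *v y c)) \<le> h * (\<alpha> * (h * R))"
      using i4 cd by (simp add: integral_unique mult_ac)
    have "y d - w (Suc j) = (y c - w j) + h *\<^sub>R (A *v (y c - w j)) + (y d - y c - b j - h *\<^sub>R (A *v y c))"
      by (simp add: wS E matrix_vector_mult_diff_distrib scaleR_diff_right)
    also have "norm \<dots> \<le> norm (y c - w j) + norm (h *\<^sub>R (A *v (y c - w j))) + h * (\<alpha> * (h * R))"
      using loc by (intro norm_triangle_le add_mono order_refl)
    also have "norm (h *\<^sub>R (A *v (y c - w j))) \<le> h * (\<alpha> * norm (y c - w j))"
      using h A[of "y c - w j"] by simp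
    finally show ?thesis by (simp add: q_def c_def d_def power2_eq_square algebra_simps)
  qed
  \<comment> \<open>Each of the j local errors receives the same crude amplification q ^ j, which
    replaces a geometric sum; q \<ge> 1 allows this for the newest error too.\<close>
  have "norm (y (real j * h) - w j) \<le> real j * q ^ j * (h\<^sup>2 * \<alpha> * R)" if "j \<le> N" for j
    using that
  proof (induction j)
    case (Suc j)
    define C where "C = h\<^sup>2 * \<alpha> * R"
    have C: "C \<ge> 0" using \<open>\<alpha> > 0\<close> R by (simp add: C_def)
    have "norm (y (real (Suc j) * h) - w (Suc j)) \<le> q * (real j * q ^ j * C) + C"
    proof -
      have "q * norm (y (real j * h) - w j) \<le> q * (real j * q ^ j * C)"
        using Suc q by (intro mult_left_mono) (auto simp: C_def)
      then show ?thesis using step[of j] Suc.prems by (simp add: C_def)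
    qed
    moreover have "C \<le> q ^ Suc j * C" using mult_right_mono[OF one_le_power[OF q, of "Suc j"] C] by simp
    moreover have "q * (real j * q ^ j * C) + q ^ Suc j * C = real (Suc j) * q ^ Suc j * C"
      by (simp add: algebra_simps)
    ultimately show ?case unfolding C_def[symmetric] by linarith
  qed (simp add: w0)
  from this[of N] have "norm (y \<tau> - w N) \<le> real N * q ^ N * (h\<^sup>2 * \<alpha> * R)" using h by simp
  also have "\<dots> \<le> real N * exp (\<alpha> * \<tau>) * (h\<^sup>2 * \<alpha> * R)"
    using qexp[of N] \<open>\<alpha> > 0\<close> R by (intro mult_right_mono mult_left_mono) auto
  also have "\<dots> = \<tau>\<^sup>2 * \<alpha> * R * exp (\<alpha> * \<tau>) / real N"
    using \<open>N \<ge> 1\<close> by (simp add: h_def power2_eq_square field_simps)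
  finally show ?thesis by (simp add: wN E_def b_def h_def)
qed

section \<open>Decay of linear systems with Hurwitz matrix\<close>

text \<open>The vector p(M) v in Horner form, so that only matrix-vector products occur.\<close>

definition poly_orbit :: "'a::field^'n^'n \<Rightarrow> 'a^'n \<Rightarrow> 'a poly \<Rightarrow> 'a^'n" where
  "poly_orbit M v p = fold_coeffs (\<lambda>a w. a *s v + M *v w) p 0"

lemma poly_orbit_0 [simp]: "poly_orbit M v 0 = 0"
  by (simp add: poly_orbit_def)

lemma poly_orbit_pCons [simp]: "poly_orbit M v (pCons a p) = a *s v + M *v poly_orbit M v p"
  by (cases "p = 0 \<and> a = 0") (auto simp: poly_orbit_def)

lemma poly_orbit_add: "poly_orbit M v (p + q) = poly_orbit M v p + poly_orbit M v q"
proof (induction p arbitrary: q)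
  case (pCons a p)
  show ?case
    by (cases q) (simp add: pCons.IH matrix_vector_right_distrib vec.scale_left_distrib)
qed simp

lemma poly_orbit_smult: "poly_orbit M v (smult c p) = c *s poly_orbit M v p"
  by (induction p) (auto simp: vec.scale_right_distrib vector_scalar_commute)

lemma poly_orbit_sum: "poly_orbit M v (\<Sum>i\<in>I. p i) = (\<Sum>i\<in>I. poly_orbit M v (p i))"
  by (induction I rule: infinite_finite_induct) (auto simp: poly_orbit_add)

lemma poly_orbit_monom: "poly_orbit M v (monom c i) = c *s (((*v) M ^^ i) v)"
  by (induction i) (auto simp: monom_0 monom_Suc vector_scalar_commute)

definition shift_mv :: "'a::field^'n^'n \<Rightarrow> 'a \<Rightarrow> 'a^'n \<Rightarrow> 'a^'n" where
  "shift_mv M \<mu> v = M *v v - \<mu> *s v"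

lemma shift_mv_add: "shift_mv M \<mu> (v + w) = shift_mv M \<mu> v + shift_mv M \<mu> w"
  by (simp add: shift_mv_def matrix_vector_right_distrib vec.scale_right_distrib)

lemma shift_mv_scale: "shift_mv M \<mu> (c *s v) = c *s shift_mv M \<mu> v"
  by (simp add: shift_mv_def vector_scalar_commute vec.scale_right_diff_distrib vec.scale_left_commute)

lemma shift_mv_commute: "shift_mv M \<mu> (M *v v) = M *v shift_mv M \<mu> v"
  by (simp add: shift_mv_def vector_scalar_commute matrix_vector_mult_diff_distrib)

lemma shift_mv_0 [simp]: "shift_mv M \<mu> 0 = 0"
  by (simp add: shift_mv_def)

lemma poly_orbit_linear_factor:
  "poly_orbit M v ([:-\<mu>, 1:] * p) = shift_mv M \<mu> (poly_orbit M v p)"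
  by (simp add: poly_orbit_add poly_orbit_smult shift_mv_def del: smult_minus_left)

lemma poly_orbit_shift_mv: "poly_orbit M (shift_mv M \<mu> v) p = shift_mv M \<mu> (poly_orbit M v p)"
  by (induction p) (auto simp: shift_mv_add shift_mv_scale shift_mv_commute)

text \<open>The head factor acts first: if the whole list annihilates v, the tail annihilates the
  image of v under the head factor. The induction for the decay estimate rests on this
  order.\<close>

fun shift_list :: "'a::field^'n^'n \<Rightarrow> 'a list \<Rightarrow> 'a^'n \<Rightarrow> 'a^'n" where
  "shift_list M [] v = v"
| "shift_list M (\<mu> # rs) v = shift_list M rs (shift_mv M \<mu> v)"

lemma shift_list_append: "shift_list M (rs @ rs') v = shift_list M rs' (shift_list M rs v)"
  by (induction rs arbitrary: v) auto

lemma shift_list_0 [simp]: "shift_list M rs 0 = 0"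
  by (induction rs) auto

text \<open>Dimension and basis arguments use the real structure of the complex vectors, polynomials
  in M the complex scalars; this connects the two.\<close>

lemma scaleR_conv_scale: "r *\<^sub>R v = complex_of_real r *s (v :: complex^'n)"
  by (simp add: vec_eq_iff, simp add: scaleR_conv_of_real)

lemma linear_shift_mv: "linear (shift_mv M \<mu> :: complex^'n \<Rightarrow> _)"
  by (rule linearI) (simp_all add: shift_mv_add shift_mv_scale scaleR_conv_scale)

lemma linear_shift_list: "linear (shift_list M rs :: complex^'n \<Rightarrow> _)"
proof (induction rs)
  case (Cons \<mu> rs)
  have "shift_list M (\<mu> # rs) = shift_list M rs \<circ> shift_mv M \<mu>" by auto
  with linear_compose[OF linear_shift_mv Cons] show ?case by metis
qed (auto intro: linearI)

section \<open>Annihilating products of eigenvalue factors\<close>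

definition eigenvalue_of :: "'a::field^'n^'n \<Rightarrow> 'a \<Rightarrow> bool" where
  "eigenvalue_of M \<mu> \<longleftrightarrow> (\<exists>v. v \<noteq> 0 \<and> M *v v = \<mu> *s v)"

text \<open>With d the real dimension, v, M v, ..., M^d v are one vector too many to be independent;
  the coefficients of a real relation between them form the polynomial.\<close>

lemma annihilating_poly_exists:
  fixes M :: "complex^'n^'n"
  shows "\<exists>p. p \<noteq> 0 \<and> poly_orbit M v p = 0"
proof -
  define d where "d = DIM(complex^'n)"
  define f where "f i = ((*v) M ^^ i) v" for i
  show ?thesis
  \<comment> \<open>Dependence is a property of sets, so a repetition among the iterates has to be
    treated separately; it gives a difference of two monomials.\<close>
  proof (cases "inj_on f {..d}")
    case False
    then obtain i j where ij: "i \<noteq> j" "f i = f j" by (auto simp: inj_on_def)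
    have "poly_orbit M v (monom 1 i + monom (-1) j) = 0"
      using ij by (simp add: poly_orbit_add poly_orbit_monom f_def)
    moreover have "coeff (monom 1 i + monom (-1) j) i \<noteq> (0 :: complex)"
      using ij by simp
    ultimately show ?thesis by (metis coeff_0)
  next
    case True
    then have "dependent (f ` {..d})"
      by (intro dependent_biggerset) (auto simp: card_image d_def)
    then obtain u w where u: "w \<in> f ` {..d}" "u w \<noteq> (0::real)" "(\<Sum>w\<in>f ` {..d}. u w *\<^sub>R w) = 0"
      using dependent_finite[of "f ` {..d}"] by auto
    then obtain k where k: "k \<le> d" "u (f k) \<noteq> 0" by auto
    define p where "p = (\<Sum>i\<le>d. monom (complex_of_real (u (f i))) i)"
    have "poly_orbit M v p = (\<Sum>i\<le>d. u (f i) *\<^sub>R f i)"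
      by (simp add: p_def poly_orbit_sum poly_orbit_monom f_def scaleR_conv_scale)
    also have "\<dots> = 0" using u(3) by (simp add: sum.reindex[OF True])
    finally have "poly_orbit M v p = 0" .
    moreover have "coeff p k \<noteq> 0" using k by (simp add: p_def coeff_sum)
    ultimately show ?thesis by (metis coeff_0)
  qed
qed

text \<open>A linear factor belonging to a number that is not an eigenvalue is injective and can be
  dropped.\<close>

lemma eigenvalue_shift_list_vector:
  fixes M :: "complex^'n^'n"
  assumes "p \<noteq> 0" "poly_orbit M v p = 0"
  shows "\<exists>rs. (\<forall>\<mu>\<in>set rs. eigenvalue_of M \<mu>) \<and> shift_list M rs v = 0"
  using assms
proof (induction "degree p" arbitrary: p v rule: less_induct)
  case less
  show ?case
  proof (cases "degree p = 0")
    case True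
    then obtain c where "p = [:c:]" by (metis degree_eq_zeroE)
    with less.prems have "v = 0" by auto
    then show ?thesis by (intro exI[of _ "[]"]) simp
  next
    case False
    then have "\<not> constant (poly p)" by (simp add: constant_degree)
    then obtain \<mu> where "poly p \<mu> = 0" using fundamental_theorem_of_algebra by blast
    then obtain q where q: "p = [:-\<mu>, 1:] * q" by (auto simp: poly_eq_0_iff_dvd)
    then have "q \<noteq> 0" using less.prems by auto
    then have deg: "degree q < degree p" by (simp add: q degree_mult_eq del: mult_pCons_left)
    have zero: "shift_mv M \<mu> (poly_orbit M v q) = 0"
      using less.prems(2) unfolding q poly_orbit_linear_factor .
    show ?thesis
    proof (cases "eigenvalue_of M \<mu>")
      case True
      \<comment> \<open>The factor commutes with q(M), so it can be moved onto the vector, which q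
        then annihilates.\<close>
      obtain rs where "\<forall>\<mu>\<in>set rs. eigenvalue_of M \<mu>" "shift_list M rs (shift_mv M \<mu> v) = 0"
        using less.hyps[OF deg \<open>q \<noteq> 0\<close>, of "shift_mv M \<mu> v"] zero by (auto simp: poly_orbit_shift_mv)
      then show ?thesis using True by (intro exI[of _ "\<mu> # rs"]) auto
    next
      case False
      then have "poly_orbit M v q = 0"
        using zero by (auto simp: eigenvalue_of_def shift_mv_def)
      then show ?thesis using less.hyps[OF deg \<open>q \<noteq> 0\<close>] by blast
    qed
  qed
qed

text \<open>Takes the place of the Cayley-Hamilton theorem. Basis vectors are added one by one: the
  list found so far is followed by one annihilating what it makes of the new vector, while earlier
  vectors are already sent to 0. Linearity extends this to all vectors.\<close>

lemma eigenvalue_shift_list: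
  fixes M :: "complex^'n^'n"
  obtains rs where "\<And>\<mu>. \<mu> \<in> set rs \<Longrightarrow> eigenvalue_of M \<mu>" "\<And>v. shift_list M rs v = 0"
proof -
  have "\<exists>rs. (\<forall>\<mu>\<in>set rs. eigenvalue_of M \<mu>) \<and> (\<forall>v\<in>V. shift_list M rs v = 0)"
    if "finite V" for V
    using that
  proof (induction V)
    case empty
    show ?case by (intro exI[of _ "[]"]) simp
  next
    case (insert v V)
    then obtain rs where rs: "\<forall>\<mu>\<in>set rs. eigenvalue_of M \<mu>" "\<forall>v\<in>V. shift_list M rs v = 0"
      by blast
    obtain rs' where rs': "\<forall>\<mu>\<in>set rs'. eigenvalue_of M \<mu>" "shift_list M rs' (shift_list M rs v) = 0"
      using annihilating_poly_exists eigenvalue_shift_list_vector by metis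
    show ?case
      using rs rs' by (intro exI[of _ "rs @ rs'"]) (auto simp: shift_list_append)
  qed
  from this[OF finite_Basis] obtain rs where rs: "\<forall>\<mu>\<in>set rs. eigenvalue_of M \<mu>"
      "\<forall>v\<in>Basis. shift_list M rs v = 0" by blast
  have "shift_list M rs = (\<lambda>v. 0)"
    using rs(2) by (intro linear_eq_stdbasis linear_shift_list linear_zero) auto
  then show thesis using that rs(1) by meson
qed

section \<open>Decay of forced linear equations\<close>

lemma scalar_ode_decay:
  fixes y g :: "real \<Rightarrow> complex"
  assumes \<mu>: "Re \<mu> < - \<sigma>" and "finite S" and cont: "continuous_on {0..b} y"
    and deriv: "\<And>t. t \<in> {0..b} - S \<Longrightarrow> (y has_vector_derivative (\<mu> * y t + g t)) (at t)"
    and bound: "\<And>t. t \<in> {0..b} - S \<Longrightarrow> norm (g t) \<le> F * exp (- \<sigma> * t)"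
    and "F \<ge> 0" and t: "t \<in> {0..b}"
  shows "norm (y t) \<le> (norm (y 0) + F / (- \<sigma> - Re \<mu>)) * exp (- \<sigma> * t)"
proof -
  \<comment> \<open>The margin that excludes resonance: after multiplication by the integrating
    factor exp (- \<mu> s), the forcing is at most F exp (\<delta> s), whose integral is bounded by
    F / \<delta> times exp (\<delta> t).\<close>
  define \<delta> where "\<delta> = - \<sigma> - Re \<mu>"
  have "\<delta> > 0" using \<mu> by (simp add: \<delta>_def)
  define w where "w s = exp (- \<mu> * of_real s) * y s" for s
  define g' where "g' s = (if s \<in> S then 0 else exp (- \<mu> * of_real s) * g s)" for s
  have wy: "norm (w s) = exp (- Re \<mu> * s) * norm (y s)" for s
    by (simp add: w_def norm_mult)
  have dexp: "((\<lambda>s. exp (- \<mu> * of_real s)) has_vector_derivative - \<mu> * exp (- \<mu> * of_real s)) (at s)" for s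
    by (rule has_vector_derivative_real_field) (auto intro!: derivative_eq_intros)
  have "(g' has_integral w t - w 0) {0..t}"
  proof (rule fundamental_theorem_of_calculus_strong[OF \<open>finite S\<close>])
    fix s assume s: "s \<in> {0..t} - S"
    have "(w has_vector_derivative exp (- \<mu> * of_real s) * (\<mu> * y s + g s)
        + (- \<mu> * exp (- \<mu> * of_real s)) * y s) (at s)"
      unfolding w_def using s t by (intro has_vector_derivative_mult dexp deriv) auto
    then show "(w has_vector_derivative g' s) (at s)"
      using s by (simp add: g'_def algebra_simps)
  next
    show "continuous_on {0..t} w"
      unfolding w_def using t
      by (intro continuous_intros continuous_on_subset[OF cont]) auto
  qed (use t in auto)
  moreover have I: "((\<lambda>s. F * exp (\<delta> * s)) has_integral F / \<delta> * exp (\<delta> * t) - F / \<delta> * exp (\<delta> * 0)) {0..t}"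
    using t \<open>\<delta> > 0\<close> by (intro fundamental_theorem_of_calculus)
      (auto intro!: derivative_eq_intros simp flip: has_real_derivative_iff_has_vector_derivative)
  moreover have "norm (g' s) \<le> F * exp (\<delta> * s)" if "s \<in> {0..t}" for s
  proof (cases "s \<in> S")
    case False
    then have "norm (g' s) \<le> exp (- Re \<mu> * s) * (F * exp (- \<sigma> * s))"
      using bound[of s] that t by (simp add: g'_def norm_mult)
    also have "\<dots> = F * exp (\<delta> * s)"
      by (simp add: \<delta>_def algebra_simps flip: exp_add)
    finally show ?thesis .
  qed (simp add: g'_def \<open>F \<ge> 0\<close>)
  ultimately have "norm (w t - w 0) \<le> F / \<delta> * exp (\<delta> * t) - F / \<delta> * exp (\<delta> * 0)"
    by (metis (no_types, lifting) has_integral_integrable integral_norm_bound_integral integral_unique)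
  also have "\<dots> \<le> F / \<delta> * exp (\<delta> * t)" using \<open>F \<ge> 0\<close> \<open>\<delta> > 0\<close> by simp
  finally have "norm (w t) \<le> norm (y 0) + F / \<delta> * exp (\<delta> * t)"
    using norm_triangle_sub[of "w t" "w 0"] wy[of 0] by simp
  moreover have "norm (y t) = exp (Re \<mu> * t) * norm (w t)" by (simp add: wy flip: exp_add)
  ultimately have "norm (y t) \<le> exp (Re \<mu> * t) * (norm (y 0) + F / \<delta> * exp (\<delta> * t))" by simp
  also have "\<dots> = exp (Re \<mu> * t) * norm (y 0) + F / \<delta> * exp (- \<sigma> * t)"
    by (simp add: \<delta>_def algebra_simps flip: exp_add)
  also have "exp (Re \<mu> * t) * norm (y 0) \<le> exp (- \<sigma> * t) * norm (y 0)"
    using t \<mu> mult_right_mono[of "Re \<mu>" "- \<sigma>" t] by (intro mult_right_mono) auto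
  finally show ?thesis by (simp add: \<delta>_def algebra_simps)
qed

lemma norm_le_sum_norm_nth:
  fixes v :: "'a::real_normed_vector^'n"
  shows "norm v \<le> (\<Sum>i\<in>UNIV. norm (v $ i))"
  unfolding norm_vec_def by (rule L2_set_le_sum) simp

text \<open>The finite set \<open>S\<close> accommodates the jumps of the input at the sampling times. Trajectories are
  confined to \<open>V\<close> so that the induction over the eigenvalue list can use \<open>V\<close> = kernel of the product
  of the remaining factors.\<close>

definition ode_decay :: "('a::real_normed_vector \<Rightarrow> 'a) \<Rightarrow> 'a set \<Rightarrow> real \<Rightarrow> real \<Rightarrow> bool" where
  "ode_decay L V \<sigma> G \<longleftrightarrow> (\<forall>y f b S F t. finite S \<longrightarrow> continuous_on {0..b} y \<longrightarrow>
    (\<forall>t\<in>{0..b} - S. (y has_vector_derivative (L (y t) + f t)) (at t)) \<longrightarrow>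
    (\<forall>t\<in>{0..b} - S. norm (f t) \<le> F * exp (- \<sigma> * t)) \<longrightarrow> 0 \<le> F \<longrightarrow>
    (\<forall>t\<in>{0..b}. y t \<in> V) \<longrightarrow> t \<in> {0..b} \<longrightarrow>
    norm (y t) \<le> G * (norm (y 0) + F) * exp (- \<sigma> * t))"

lemma ode_decayI:
  assumes "\<And>y f b S F t. \<lbrakk>finite S; continuous_on {0..b} y;
    \<And>t. t \<in> {0..b} - S \<Longrightarrow> (y has_vector_derivative (L (y t) + f t)) (at t);
    \<And>t. t \<in> {0..b} - S \<Longrightarrow> norm (f t) \<le> F * exp (- \<sigma> * t); 0 \<le> F;
    \<And>t. t \<in> {0..b} \<Longrightarrow> y t \<in> V; t \<in> {0..b}\<rbrakk>
    \<Longrightarrow> norm (y t) \<le> G * (norm (y 0) + F) * exp (- \<sigma> * t)"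
  shows "ode_decay L V \<sigma> G"
  unfolding ode_decay_def
proof (intro allI impI)
  fix y f b S F t
  assume "finite S" "continuous_on {0..b} y"
    "\<forall>t\<in>{0..b} - S. (y has_vector_derivative (L (y t) + f t)) (at t)"
    "\<forall>t\<in>{0..b} - S. norm (f t) \<le> F * exp (- \<sigma> * t)" "0 \<le> F"
    "\<forall>t\<in>{0..b}. y t \<in> V" "t \<in> {0..b}"
  note h = this
  show "norm (y t) \<le> G * (norm (y 0) + F) * exp (- \<sigma> * t)"
  proof (rule assms[where y = y and f = f and b = b and S = S and F = F and t = t])
  qed (use h in \<open>simp_all only:\<close>)
qed

lemma ode_decayD:
  assumes "ode_decay L V \<sigma> G" "finite S" "continuous_on {0..b} y"
    and "\<And>t. t \<in> {0..b} - S \<Longrightarrow> (y has_vector_derivative (L (y t) + f t)) (at t)"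
    and "\<And>t. t \<in> {0..b} - S \<Longrightarrow> norm (f t) \<le> F * exp (- \<sigma> * t)"
    and "0 \<le> F" "\<And>t. t \<in> {0..b} \<Longrightarrow> y t \<in> V" "t \<in> {0..b}"
  shows "norm (y t) \<le> G * (norm (y 0) + F) * exp (- \<sigma> * t)"
proof (rule assms(1)[unfolded ode_decay_def, rule_format, where y = y and f = f and b = b and S = S and F = F and t = t])
qed (fact assms)+

text \<open>For D = M - \<mu> I, the function D Y solves the same equation with forcing D f and
  stays in the kernel of the remaining factors, so it decays by induction. Then Y' = \<mu> Y + (D Y
  + f) splits into scalar equations with decaying forcing.\<close>

lemma shift_list_ode_decay:
  fixes M :: "complex^'n^'n"
  assumes "\<And>\<mu>. \<mu> \<in> set rs \<Longrightarrow> Re \<mu> < - \<sigma>"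
  shows "\<exists>G\<ge>0. ode_decay ((*v) M) {v. shift_list M rs v = 0} \<sigma> G"
  using assms
proof (induction rs)
  case Nil
  \<comment> \<open>The empty product is the identity, so its kernel admits only the zero
    trajectory.\<close>
  show ?case by (intro exI[of _ 0] conjI ode_decayI) auto
next
  case (Cons \<mu> rs)
  define D where "D = shift_mv M \<mu>"
  have linD: "linear D" by (simp add: D_def linear_shift_mv)
  obtain c where "c > 0" and c: "\<And>v. norm (D v) \<le> norm v * c"
    using bounded_linear.pos_bounded linD linear_conv_bounded_linear by metis
  obtain G where "G \<ge> 0" and G: "ode_decay ((*v) M) {v. shift_list M rs v = 0} \<sigma> G"
    using Cons by auto
  define \<delta> where "\<delta> = - \<sigma> - Re \<mu>"
  have "\<delta> > 0" using Cons.prems[of \<mu>] by (simp add: \<delta>_def)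
  \<comment> \<open>G c + 1 bounds the new forcing D Y + f, division by \<delta> is the cost of the
    scalar equation, and the leading 1 covers the initial value.\<close>
  define H where "H = 1 + (G * c + 1) / \<delta>"
  have "H \<ge> 0" using \<open>G \<ge> 0\<close> \<open>c > 0\<close> \<open>\<delta> > 0\<close> by (simp add: H_def)
  show ?case
  proof (intro exI[of _ "real CARD('n) * H"] conjI ode_decayI)
    show "0 \<le> real CARD('n) * H" using \<open>H \<ge> 0\<close> by simp
    fix Y f :: "real \<Rightarrow> complex^'n" and b F t :: real and S
    assume S: "finite S" and cont: "continuous_on {0..b} Y"
      and deriv: "\<And>t. t \<in> {0..b} - S \<Longrightarrow> (Y has_vector_derivative (M *v Y t + f t)) (at t)"
      and f: "\<And>t. t \<in> {0..b} - S \<Longrightarrow> norm (f t) \<le> F * exp (- \<sigma> * t)" and "0 \<le> F"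
      and zero: "\<And>t. t \<in> {0..b} \<Longrightarrow> Y t \<in> {v. shift_list M (\<mu> # rs) v = 0}" and t: "t \<in> {0..b}"
    have DY: "norm (D (Y s)) \<le> G * (norm (D (Y 0)) + F * c) * exp (- \<sigma> * s)" if s: "s \<in> {0..b}" for s
    proof (rule ode_decayD[OF G S _ _ _ _ _ s])
      show "continuous_on {0..b} (\<lambda>s. D (Y s))"
        by (rule linear_continuous_on_compose[OF cont linD])
      fix s assume s: "s \<in> {0..b} - S"
      have "((\<lambda>s. D (Y s)) has_vector_derivative D (M *v Y s + f s)) (at s)"
        by (rule bounded_linear.has_vector_derivative[OF linD[unfolded linear_conv_bounded_linear] deriv[OF s]])
      then show "((\<lambda>s. D (Y s)) has_vector_derivative M *v D (Y s) + D (f s)) (at s)"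
        by (simp add: D_def shift_mv_add shift_mv_commute)
      have "norm (D (f s)) \<le> (F * exp (- \<sigma> * s)) * c"
        using f[OF s] \<open>c > 0\<close> by (intro order_trans[OF c] mult_right_mono) auto
      then show "norm (D (f s)) \<le> F * c * exp (- \<sigma> * s)" by (simp add: mult_ac)
    qed (use zero \<open>0 \<le> F\<close> \<open>c > 0\<close> in \<open>auto simp: D_def\<close>)
    have DY': "norm (D (Y s)) \<le> G * c * (norm (Y 0) + F) * exp (- \<sigma> * s)" if s: "s \<in> {0..b}" for s
    proof -
      have "G * (norm (D (Y 0)) + F * c) \<le> G * (norm (Y 0) * c + F * c)"
        using c[of "Y 0"] \<open>G \<ge> 0\<close> by (intro mult_left_mono add_right_mono)
      also have "\<dots> = G * c * (norm (Y 0) + F)" by (simp add: algebra_simps)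
      finally show ?thesis using DY[OF s] by (meson exp_ge_zero mult_right_mono order_trans)
    qed
    define F' where "F' = (G * c + 1) * (norm (Y 0) + F)"
    have "F' \<ge> 0" using \<open>G \<ge> 0\<close> \<open>c > 0\<close> \<open>0 \<le> F\<close> by (simp add: F'_def)
    have comp: "norm (Y t $ i) \<le> H * (norm (Y 0) + F) * exp (- \<sigma> * t)" for i
    proof -
      have "norm (Y t $ i) \<le> (norm (Y 0 $ i) + F' / (- \<sigma> - Re \<mu>)) * exp (- \<sigma> * t)"
      proof (rule scalar_ode_decay[OF _ S _ _ _ \<open>F' \<ge> 0\<close> t])
        show "Re \<mu> < - \<sigma>" using Cons.prems by simp
        show "continuous_on {0..b} (\<lambda>s. Y s $ i)" by (intro continuous_intros cont)
        fix s assume s: "s \<in> {0..b} - S"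
        have "((\<lambda>s. Y s $ i) has_vector_derivative (M *v Y s + f s) $ i) (at s)"
          by (rule bounded_linear.has_vector_derivative[OF bounded_linear_vec_nth deriv[OF s]])
        then show "((\<lambda>s. Y s $ i) has_vector_derivative \<mu> * Y s $ i + (D (Y s) + f s) $ i) (at s)"
          by (simp add: D_def shift_mv_def)
        have "norm ((D (Y s) + f s) $ i) \<le> norm (D (Y s) + f s)" by (rule Finite_Cartesian_Product.norm_nth_le)
        also have "\<dots> \<le> G * c * (norm (Y 0) + F) * exp (- \<sigma> * s) + F * exp (- \<sigma> * s)"
          using DY'[of s] f[OF s] s by (intro norm_triangle_le add_mono) auto
        also have "F * exp (- \<sigma> * s) \<le> (norm (Y 0) + F) * exp (- \<sigma> * s)"
          by (intro mult_right_mono) auto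
        finally show "norm ((D (Y s) + f s) $ i) \<le> F' * exp (- \<sigma> * s)"
          by (simp add: F'_def algebra_simps)
      qed
      also have "\<dots> \<le> (norm (Y 0) + F + F' / \<delta>) * exp (- \<sigma> * t)"
        using Finite_Cartesian_Product.norm_nth_le[of "Y 0" i] \<open>0 \<le> F\<close>
        by (intro mult_right_mono) (auto simp: \<delta>_def)
      also have "norm (Y 0) + F + F' / \<delta> = H * (norm (Y 0) + F)"
        by (simp add: F'_def H_def algebra_simps)
      finally show ?thesis .
    qed
    have "norm (Y t) \<le> (\<Sum>i\<in>(UNIV :: 'n set). H * (norm (Y 0) + F) * exp (- \<sigma> * t))"
      by (intro order_trans[OF norm_le_sum_norm_nth] sum_mono comp)
    then show "norm (Y t) \<le> real CARD('n) * H * (norm (Y 0) + F) * exp (- \<sigma> * t)"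
      by (simp add: mult_ac)
  qed
qed

section \<open>Complexification and real Hurwitz matrices\<close>

definition complexify :: "real^'n \<Rightarrow> complex^'n" where
  "complexify v = (\<chi> i. complex_of_real (v $ i))"

lemma norm_complexify [simp]: "norm (complexify v) = norm v"
  by (simp add: complexify_def norm_vec_def)

lemma linear_complexify: "linear complexify"
  by (rule linearI) (simp_all add: complexify_def vec_eq_iff, simp add: scaleR_conv_of_real)

lemma complexify_mult: "complexify (M *v v) = map_matrix complex_of_real M *v complexify v"
  by (simp add: complexify_def vec_eq_iff matrix_vector_mult_def map_matrix_def)

lemma hurwitz_ode_decay:
  fixes M :: "real^'n^'n"
  assumes "hurwitz M"
  shows "\<exists>\<sigma>>0. \<exists>G\<ge>0. ode_decay ((*v) M) UNIV \<sigma> G"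
proof -
  define M' where "M' = map_matrix complex_of_real M"
  obtain rs where rs: "\<And>\<mu>. \<mu> \<in> set rs \<Longrightarrow> eigenvalue_of M' \<mu>" and zero: "\<And>v. shift_list M' rs v = 0"
    using eigenvalue_shift_list[where M = M'] by blast
  have "Re \<mu> < 0" if "\<mu> \<in> set rs" for \<mu>
    using assms rs[OF that] by (auto simp: hurwitz_def eigenvalue_of_def M'_def)
  \<comment> \<open>Finitely many negative real parts leave room for a common margin; the strict
    inequality is what the scalar estimate needs.\<close>
  then have "\<exists>\<sigma>>0. \<forall>\<mu>\<in>set rs. Re \<mu> < - \<sigma>"
  proof (induction rs)
    case (Cons \<mu> rs)
    then obtain \<sigma> where "\<sigma> > 0" "\<forall>\<mu>\<in>set rs. Re \<mu> < - \<sigma>" by auto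
    moreover have "Re \<mu> < 0" using Cons.prems by simp
    ultimately show ?case by (intro exI[of _ "min \<sigma> (- Re \<mu> / 2)"]) (auto simp: min_def)
  qed (auto intro: exI[of _ 1])
  then obtain \<sigma> where "\<sigma> > 0" and \<sigma>: "\<And>\<mu>. \<mu> \<in> set rs \<Longrightarrow> Re \<mu> < - \<sigma>" by blast
  obtain G where "G \<ge> 0" and G: "ode_decay ((*v) M') UNIV \<sigma> G"
    using shift_list_ode_decay[of rs \<sigma> M'] \<sigma> by (auto simp: zero)
  show ?thesis
  proof (intro exI conjI \<open>\<sigma> > 0\<close> \<open>G \<ge> 0\<close> ode_decayI)
    fix y f :: "real \<Rightarrow> real^'n" and b F t :: real and S
    assume S: "finite S" and cont: "continuous_on {0..b} y"
      and deriv: "\<And>t. t \<in> {0..b} - S \<Longrightarrow> (y has_vector_derivative (M *v y t + f t)) (at t)"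
      and f: "\<And>t. t \<in> {0..b} - S \<Longrightarrow> norm (f t) \<le> F * exp (- \<sigma> * t)" and "0 \<le> F" and t: "t \<in> {0..b}"
    have "norm (complexify (y t)) \<le> G * (norm (complexify (y 0)) + F) * exp (- \<sigma> * t)"
    proof (rule ode_decayD[OF G S _ _ _ \<open>0 \<le> F\<close> UNIV_I t])
      show "continuous_on {0..b} (\<lambda>s. complexify (y s))"
        by (rule linear_continuous_on_compose[OF cont linear_complexify])
      fix s assume s: "s \<in> {0..b} - S"
      have "((\<lambda>s. complexify (y s)) has_vector_derivative complexify (M *v y s + f s)) (at s)"
        by (rule bounded_linear.has_vector_derivative[OF linear_complexify[unfolded linear_conv_bounded_linear] deriv[OF s]])
      then show "((\<lambda>s. complexify (y s)) has_vector_derivative M' *v complexify (y s) + complexify (f s)) (at s)"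
        by (simp add: M'_def complexify_mult linear_add[OF linear_complexify])
      show "norm (complexify (f s)) \<le> F * exp (- \<sigma> * s)" using f[OF s] by simp
    qed
    then show "norm (y t) \<le> G * (norm (y 0) + F) * exp (- \<sigma> * t)" by simp
  qed (rule \<open>\<sigma> > 0\<close> \<open>G \<ge> 0\<close>)+
qed

section \<open>The closed loop\<close>

text \<open>Both u0 and z on a sampling interval are controlled only up to, not at, the right
  endpoint; a single point does not affect integrability.\<close>

lemma integrable_on_measurable_bounded_half_open:
  fixes f :: "real \<Rightarrow> 'a::euclidean_space"
  assumes "f \<in> borel_measurable (lebesgue_on {a..<b})" "bounded (f ` {a..<b})" "a \<le> b"
  shows "f integrable_on {a..b}"
proof -
  obtain c where "\<forall>y\<in>f ` {a..<b}. norm y \<le> c"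
    using assms(2) unfolding bounded_iff by blast
  then have c: "norm (f t) \<le> c" if "t \<in> {a..<b}" for t
    using that by blast
  have "f integrable_on {a..<b}"
    by (rule measurable_bounded_by_integrable_imp_integrable[where g = "\<lambda>_. c"])
      (use assms c in \<open>auto intro!: integrable_on_const bounded_set_imp_lmeasurable\<close>)
  moreover have "{a..b} = insert b {a..<b}" using \<open>a \<le> b\<close> by auto
  ultimately show ?thesis by (simp add: integrable_on_insert_iff)
qed

lemma absolutely_continuous_on_subset:
  "absolutely_continuous_on S f \<Longrightarrow> S' \<subseteq> S \<Longrightarrow> absolutely_continuous_on S' f"
  unfolding absolutely_continuous_on_def
  by (elim all_forward imp_forward ex_forward conj_forward; blast)

text \<open>The constant of \<open>euler_error\<close>, with R replaced by the coefficient of |x t0|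
  + V in a bound on the speed of x over one delay window; that bound comes from
  \<open>gronwall_bound\<close>.\<close>

definition predictor_error_const :: "real \<Rightarrow> real \<Rightarrow> real \<Rightarrow> real" where
  "predictor_error_const \<alpha> \<beta> \<tau> =
     \<tau>\<^sup>2 * \<alpha> * exp (\<alpha> * \<tau>) * (2 * \<alpha> * exp (2 * \<alpha> * \<tau>) * (1 + \<beta> * \<tau>) + \<beta>)"

locale closed_loop =
  fixes A :: "real^'n^'n" and B :: "real^'m^'n" and k :: "real^'n^'m" and \<tau> :: real
    and N :: nat and T :: "nat \<Rightarrow> real" and r :: real
    and x0 :: "real^'n" and u0 :: "real \<Rightarrow> real^'m"
    and x z :: "real \<Rightarrow> real^'n" and u :: "real \<Rightarrow> real^'m"
    and \<alpha> \<beta> \<kappa> :: real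
  assumes tau: "\<tau> > 0" and N: "N \<ge> 1"
    and part: "time_partition T" and mesh: "mesh_le T r"
    and u0: "L_infinity_on {-\<tau>..<0} u0"
    and sol: "closed_loop_solution A B k \<tau> N T x0 u0 x z u"
    and \<alpha>: "\<alpha> > 0" "\<And>v. norm (A *v v) \<le> \<alpha> * norm v"
    and \<beta>: "\<beta> > 0" "\<And>v. norm (B *v v) \<le> \<beta> * norm v"
    and \<kappa>: "\<kappa> > 0" "\<And>v. norm (k *v v) \<le> \<kappa> * norm v"
begin

definition p :: "real \<Rightarrow> real^'n" where "p t = x (t + \<tau>)"
definition e :: "real \<Rightarrow> real^'n" where "e t = z t - p t"
abbreviation C :: real where "C \<equiv> predictor_error_const \<alpha> \<beta> \<tau>"
definition D :: real where "D = norm x0 + (SUP s\<in>{-\<tau>..<0}. norm (u0 s))"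

section \<open>Sampling times, initial data and integral identities\<close>

lemma T_0: "T 0 = 0" and T_mono: "strict_mono T"
  using part by (auto simp: time_partition_def)

lemma T_nonneg: "0 \<le> T i"
  using T_mono T_0 by (metis less_eq_nat.simps(1) strict_mono_less_eq)

lemma T_less_Suc: "T i < T (Suc i)"
  using T_mono by (simp add: strict_mono_less)

lemma T_step: "T (Suc i) - T i \<le> r"
proof -
  have "T (Suc i) - T i \<le> (SUP i. T (Suc i) - T i)"
    using mesh by (intro cSUP_upper) (auto simp: mesh_le_def)
  then show ?thesis using mesh by (simp add: mesh_le_def)
qed

lemma T_unbounded: "\<exists>i. t < T i"
  using part unfolding time_partition_def filterlim_at_top_dense eventually_sequentially by blast

lemma T_locate:
  assumes "0 \<le> t"
  obtains i where "T i \<le> t" "t < T (Suc i)"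
proof -
  define n where "n = (LEAST i. t < T i)"
  have n: "t < T n" unfolding n_def using T_unbounded by (rule LeastI_ex)
  then have "n \<noteq> 0" using assms T_0 by (metis not_less)
  then obtain i where i: "n = Suc i" using not0_implies_Suc by blast
  then have "\<not> t < T i" unfolding n_def by (metis lessI n_def not_less_Least)
  then show thesis using that[of i] n i by simp
qed

lemma u_past: "s \<in> {-\<tau>..<0} \<Longrightarrow> u s = u0 s"
  and u_future: "t \<ge> 0 \<Longrightarrow> u t = k *v z t"
  and x_0: "x 0 = x0"
  and z_T: "z (T i) = approx_predictor A B \<tau> N (x (T i)) u (T i)"
  and z_deriv: "t \<in> {T i..<T (Suc i)} \<Longrightarrow>
        (z has_vector_derivative ((A + B ** k) *v z t)) (at t within {T i..<T (Suc i)})"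
  using sol by (auto simp: closed_loop_solution_def)

lemma bdd_u0: "bdd_above ((\<lambda>s. norm (u0 s)) ` {-\<tau>..<0})"
proof -
  have "bdd_above (norm ` u0 ` {-\<tau>..<0})"
    using u0 by (simp add: L_infinity_on_def bdd_above_norm)
  then show ?thesis by (simp only: image_image)
qed

lemma norm_u_past: "s \<in> {-\<tau>..<0} \<Longrightarrow> norm (u s) \<le> D"
  using cSUP_upper[OF _ bdd_u0, of s] norm_ge_zero[of x0] by (simp add: u_past D_def add_increasing)

lemma norm_x0: "norm x0 \<le> D"
proof -
  have "0 \<le> norm (u0 (-\<tau>))" by simp
  also have "\<dots> \<le> (SUP s\<in>{-\<tau>..<0}. norm (u0 s))"
    using tau by (intro cSUP_upper bdd_u0) auto
  finally show ?thesis by (simp add: D_def)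
qed

lemma D_nonneg: "0 \<le> D"
  using norm_x0 norm_ge_zero order_trans by blast

lemma x_cont: "0 \<le> a \<Longrightarrow> continuous_on {a..b} x"
proof -
  assume "0 \<le> a"
  \<comment> \<open>The solution concept speaks of positive b only, hence the maximum.\<close>
  have "absolutely_continuous_on {0..max 1 b} x"
    using sol by (simp add: closed_loop_solution_def)
  then show ?thesis
    using \<open>0 \<le> a\<close> by (intro continuous_on_subset[OF absolutely_continuous_on_imp_continuous_on]) auto
qed

lemma x_integral:
  assumes "0 \<le> a" "a \<le> b"
  shows "((\<lambda>s. A *v x s + B *v u (s - \<tau>)) has_integral x b - x a) {a..b}"
proof -
  have "AE t in lebesgue. 0 \<le> t \<longrightarrow>
        (x has_vector_derivative (A *v x t + B *v u (t - \<tau>))) (at t)"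
    using sol by (simp add: closed_loop_solution_def)
  then obtain Z where Z: "\<And>t. t \<in> space lebesgue - Z \<Longrightarrow> 0 \<le> t \<longrightarrow>
        (x has_vector_derivative (A *v x t + B *v u (t - \<tau>))) (at t)" "Z \<in> null_sets lebesgue"
    by (rule AE_E3) blast
  have "absolutely_continuous_on {0..b + 1} x"
    using sol assms by (simp add: closed_loop_solution_def)
  then have ac: "absolutely_continuous_on {a..b} x"
    using assms by (auto intro: absolutely_continuous_on_subset)
  show ?thesis
  proof (rule has_integral_derivative_absolutely_continuous[OF \<open>a \<le> b\<close> ac])
    show "negligible Z" using Z(2) by (simp add: negligible_iff_null_sets)
    fix t assume "t \<in> {a..b} - Z"
    then show "(x has_vector_derivative (A *v x t + B *v u (t - \<tau>))) (at t within {a..b})"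
      using Z(1)[of t] assms by (simp add: has_vector_derivative_at_within)
  qed
qed

lemma x_integral_shift:
  assumes "0 \<le> a + c" "a \<le> b"
  shows "((\<lambda>s. A *v x (s + c) + B *v u (s + c - \<tau>)) has_integral x (b + c) - x (a + c)) {a..b}"
  using has_integral_shift_real_ivl[OF x_integral[of "a + c" "b + c"], of c] assms by simp

lemma z_cont: "continuous_on {T i..<T (Suc i)} z"
  by (rule continuous_on_vector_derivative[OF z_deriv])

lemma z_integral:
  assumes "T i \<le> t" "t < T (Suc i)"
  shows "((\<lambda>s. (A + B ** k) *v z s) has_integral z t - z (T i)) {T i..t}"
  using assms
  by (intro fundamental_theorem_of_calculus) (auto intro!: has_vector_derivative_within_subset[OF z_deriv])

text \<open>The solution concept gives no left limit of z at \<open>T (Suc i)\<close>. The Gronwall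
  bound on [T i, t] is uniform in t, which excludes blow-up and makes u integrable across the
  sampling time.\<close>

lemma z_bounded: "bounded (z ` {T i..<T (Suc i)})"
proof -
  obtain c where c: "c > 0" "\<And>v. norm ((A + B ** k) *v v) \<le> c * norm v"
    using matrix_norm_bound by blast
  have "norm (z t) \<le> 2 * exp (2 * c * r) * norm (z (T i))" if t: "t \<in> {T i..<T (Suc i)}" for t
  proof -
    have "norm (z t) \<le> 2 * exp (2 * c * (t - T i)) * (norm (z (T i)) + 0 * (t - T i))"
      using t c z_integral[of i]
      by (intro gronwall_bound[where h = "\<lambda>s. (A + B ** k) *v z s"])
        (auto intro: continuous_on_subset[OF z_cont[of i]])
    also have "\<dots> \<le> 2 * exp (2 * c * r) * (norm (z (T i)) + 0 * (t - T i))"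
      using t c T_step[of i] by (intro mult_right_mono mult_left_mono) auto
    finally show ?thesis by simp
  qed
  then have "\<forall>y\<in>z ` {T i..<T (Suc i)}. norm y \<le> 2 * exp (2 * c * r) * norm (z (T i))"
    by blast
  then show ?thesis unfolding bounded_iff by (rule exI)
qed

text \<open>Without integrability the integrals in the predictor would only be default values. The
  initial piece and the sampling intervals are joined by induction.\<close>

lemma u_integrable:
  assumes "- \<tau> \<le> a"
  shows "u integrable_on {a..b}"
proof -
  have past: "u integrable_on {- \<tau>..0}"
  proof -
    have "u0 integrable_on {- \<tau>..0}"
      using u0 tau by (intro integrable_on_measurable_bounded_half_open) (auto simp: L_infinity_on_def)
    then show ?thesis by (rule integrable_spike_finite[of "{0}", rotated 2]) (auto simp: u_past)
  qed
  have step: "u integrable_on {T i..T (Suc i)}" for i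
  proof -
    have "(\<lambda>t. k *v z t) integrable_on {T i..T (Suc i)}"
    proof (rule integrable_on_measurable_bounded_half_open)
      show "(\<lambda>t. k *v z t) \<in> borel_measurable (lebesgue_on {T i..<T (Suc i)})"
        by (intro continuous_imp_measurable_on_sets_lebesgue
            linear_continuous_on_compose[OF z_cont matrix_vector_mul_linear]) auto
      show "bounded ((\<lambda>t. k *v z t) ` {T i..<T (Suc i)})"
        using bounded_linear_image[OF z_bounded matrix_vector_mul_bounded_linear[of k]]
        by (simp add: image_image)
    qed (use T_less_Suc less_imp_le in blast)
    then show ?thesis
      using T_nonneg[of i] by (rule_tac integrable_spike_finite[of "{}", rotated 2]) (auto simp: u_future)
  qed
  have "u integrable_on {- \<tau>..T i}" for i
  proof (induction i)
    case (Suc i)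
    then show ?case
      using step[of i] tau T_nonneg[of i] T_less_Suc[of i]
      by - (rule Henstock_Kurzweil_Integration.integrable_combine[of "- \<tau>" "T i" "T (Suc i)"], auto)
  qed (simp add: past T_0)
  moreover obtain i where "b < T i" using T_unbounded by blast
  ultimately show ?thesis using assms by - (rule integrable_subinterval_real[of u "- \<tau>" "T i"], auto)
qed

text \<open>The input at the right endpoint of the window is not covered by the bound on the past input,
  so the integrand is modified there.\<close>

context
  fixes t0 V :: real
  assumes t0: "t0 \<ge> 0" and V: "\<And>s. s \<in> {t0 - \<tau>..<t0} \<Longrightarrow> norm (u s) \<le> V"
begin

definition g :: "real \<Rightarrow> real^'n" where
  "g s = (if s < \<tau> then B *v u (t0 - \<tau> + s) else 0)"

lemma V_nonneg: "V \<ge> 0"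
proof -
  have "norm (u (t0 - \<tau>)) \<le> V" using tau by (intro V) auto
  then show ?thesis using norm_ge_zero order_trans by blast
qed

lemma window_integral:
  assumes "0 \<le> c" "c \<le> d" "d \<le> \<tau>"
  shows "((\<lambda>s. A *v x (s + t0) + g s) has_integral x (d + t0) - x (c + t0)) {c..d}"
  by (rule has_integral_spike_finite[of "{\<tau>}", OF _ _ x_integral_shift[of c t0 d]])
    (use assms t0 in \<open>auto simp: g_def algebra_simps\<close>)

lemma norm_g:
  assumes "s \<in> {0..\<tau>}"
  shows "norm (g s) \<le> \<beta> * V"
proof (cases "s < \<tau>")
  case True
  then have "norm (u (t0 - \<tau> + s)) \<le> V" using assms by (intro V) auto
  then show ?thesis
    using True \<beta>(1) order_trans[OF \<beta>(2) mult_left_mono] by (simp add: g_def)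
qed (use \<beta> V_nonneg in \<open>simp add: g_def\<close>)

lemma norm_rhs:
  assumes "s \<in> {0..\<tau>}"
  shows "norm (A *v x (s + t0) + g s) \<le> \<alpha> * norm (x (s + t0)) + \<beta> * V"
  using \<alpha>(2) norm_g[OF assms] by (intro norm_triangle_le add_mono)

lemma window_cont: "continuous_on {0..\<tau>} (\<lambda>s. x (s + t0))"
  by (intro continuous_on_compose2[OF x_cont[of 0 "\<tau> + t0"]] continuous_intros) (use t0 in auto)

lemma window_bound:
  assumes "s \<in> {0..\<tau>}"
  shows "norm (x (s + t0)) \<le> 2 * exp (2 * \<alpha> * \<tau>) * (norm (x t0) + \<beta> * \<tau> * V)"
proof -
  have int: "((\<lambda>s. A *v x (s + t0) + g s) has_integral x (t + t0) - x (0 + t0)) {0..t}"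
    if "t \<in> {0..\<tau>}" for t
    using that by (intro window_integral) auto
  have "norm (x (s + t0)) \<le> 2 * exp (2 * \<alpha> * (\<tau> - 0)) * (norm (x (0 + t0)) + \<beta> * V * (\<tau> - 0))"
    by (rule gronwall_bound[OF \<alpha>(1) _ _ window_cont int norm_rhs assms])
      (use \<beta> V_nonneg tau in auto)
  then show ?thesis by (simp add: mult_ac)
qed

text \<open>Shifted to [0, \<tau>], the window turns the delayed equation into one with known
  forcing g, and the predictor is its Euler scheme with N steps.\<close>

lemma window_error:
  "norm (approx_predictor A B \<tau> N (x t0) u t0 - x (t0 + \<tau>)) \<le> C / real N * (norm (x t0) + V)"
proof -
  \<comment> \<open>Bounds the speed of x over the window: \<open>window_bound\<close> is inserted
    into \<alpha> |x| + \<beta> V, and everything is enlarged to a multiple of |x t0| + V.\<close>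
  define R where "R = (2 * \<alpha> * exp (2 * \<alpha> * \<tau>) * (1 + \<beta> * \<tau>) + \<beta>) * (norm (x t0) + V)"
  have R_nonneg: "R \<ge> 0" using \<alpha> \<beta> tau V_nonneg by (simp add: R_def)
  define h where "h = \<tau> / real N"
  define E where "E = mat 1 + h *\<^sub>R A"
  have "h > 0" "real N * h = \<tau>" using tau N by (auto simp: h_def)
  have g_int: "(g has_integral B *v integral {c..d} (\<lambda>s. u (t0 - \<tau> + s))) {c..d}"
    if "0 \<le> c" "c \<le> d" "d \<le> \<tau>" for c d
  proof -
    have "(\<lambda>s. u (s + (t0 - \<tau>))) integrable_on {c..d}"
      using integrable_shift_real_ivl[OF u_integrable[of "c + (t0 - \<tau>)" "d + (t0 - \<tau>)"], of "t0 - \<tau>"]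
        that t0 by simp
    then have "(\<lambda>s. u (t0 - \<tau> + s)) integrable_on {c..d}" by (simp add: add.commute)
    then have "((\<lambda>s. B *v u (t0 - \<tau> + s)) has_integral B *v integral {c..d} (\<lambda>s. u (t0 - \<tau> + s))) {c..d}"
      using has_integral_linear[OF integrable_integral matrix_vector_mul_bounded_linear[of B]]
      by (simp add: o_def)
    then show ?thesis
      by (rule has_integral_spike_finite[of "{\<tau>}", rotated 2]) (use that in \<open>auto simp: g_def\<close>)
  qed
  have main: "norm (x (\<tau> + t0) - (matrix_power E N *v x (0 + t0)
     + (\<Sum>j<N. matrix_power E (N - 1 - j) *v integral {real j * h..real (j + 1) * h} g)))
     \<le> \<tau>\<^sup>2 * \<alpha> * R * exp (\<alpha> * \<tau>) / real N"
    unfolding E_def h_def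
  proof (rule euler_error[OF \<alpha> tau N R_nonneg window_cont])
    fix c d assume cd: "0 \<le> c" "c \<le> d" "d \<le> \<tau>"
    show "((\<lambda>s. A *v x (s + t0) + g s) has_integral x (d + t0) - x (c + t0)) {c..d}"
      using window_integral cd .
    show "g integrable_on {c..d}" using g_int[OF cd] by blast
  next
    fix s assume s: "s \<in> {0..\<tau>}"
    have "\<alpha> * norm (x (s + t0)) \<le> \<alpha> * (2 * exp (2 * \<alpha> * \<tau>) * (norm (x t0) + \<beta> * \<tau> * V))"
      using window_bound[OF s] \<alpha>(1) by (intro mult_left_mono) auto
    also have "\<dots> = 2 * \<alpha> * exp (2 * \<alpha> * \<tau>) * (norm (x t0) + \<beta> * \<tau> * V)" by simp
    also have "\<dots> \<le> 2 * \<alpha> * exp (2 * \<alpha> * \<tau>) * ((1 + \<beta> * \<tau>) * (norm (x t0) + V))"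
      using \<alpha>(1) \<beta>(1) tau V_nonneg
      by (intro mult_left_mono) (auto simp: distrib_left distrib_right intro: add_mono)
    finally have "\<alpha> * norm (x (s + t0)) \<le> 2 * \<alpha> * exp (2 * \<alpha> * \<tau>) * ((1 + \<beta> * \<tau>) * (norm (x t0) + V))" .
    moreover have "\<beta> * V \<le> \<beta> * (norm (x t0) + V)"
      using \<beta>(1) by (intro mult_left_mono) auto
    moreover have "R = 2 * \<alpha> * exp (2 * \<alpha> * \<tau>) * ((1 + \<beta> * \<tau>) * (norm (x t0) + V)) + \<beta> * (norm (x t0) + V)"
      unfolding R_def distrib_right[of _ \<beta>] mult.assoc ..
    ultimately show "norm (A *v x (s + t0) + g s) \<le> R"
      using norm_rhs[OF s] by linarith
  qed
  \<comment> \<open>Changing the forcing at the single time \<tau> changes no integral, so the Euler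
    iterate is exactly the predictor.\<close>
  have P: "matrix_power E N *v x (0 + t0)
     + (\<Sum>j<N. matrix_power E (N - 1 - j) *v integral {real j * h..real (j + 1) * h} g)
     = approx_predictor A B \<tau> N (x t0) u t0"
  proof -
    have "integral {real j * h..real (j + 1) * h} g
      = B *v integral {real j * h..real (j + 1) * h} (\<lambda>s. u (t0 - \<tau> + s))" if "j < N" for j
    proof (rule integral_unique[OF g_int])
      have "real (j + 1) * h \<le> real N * h" using that \<open>h > 0\<close> by (intro mult_right_mono) auto
      then show "real (j + 1) * h \<le> \<tau>" using \<open>real N * h = \<tau>\<close> by simp
    qed (use \<open>h > 0\<close> in auto)
    then show ?thesis
      by (simp add: approx_predictor_def E_def h_def matrix_vector_mul_assoc)
  qed
  have C: "\<tau>\<^sup>2 * \<alpha> * R * exp (\<alpha> * \<tau>) / real N = C / real N * (norm (x t0) + V)"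
    by (simp add: predictor_error_const_def R_def)
  from main show ?thesis unfolding P C add.commute[of \<tau>] by (subst norm_minus_commute)
qed

end

section \<open>Prediction error and future state\<close>

lemma norm_e_sample:
  assumes "\<And>s. s \<in> {T i - \<tau>..<T i} \<Longrightarrow> norm (u s) \<le> V"
  shows "norm (e (T i)) \<le> C / real N * (norm (x (T i)) + V)"
  using window_error[OF T_nonneg assms] by (simp add: e_def p_def z_T)

lemma p_cont: "0 \<le> a \<Longrightarrow> continuous_on {a..b} p"
  unfolding p_def
  by (intro continuous_on_compose2[OF x_cont[of 0 "b + \<tau>"]] continuous_intros) (use tau in auto)

lemma p_integral:
  assumes "0 \<le> a" "a \<le> b"
  shows "((\<lambda>s. A *v p s + B *v u s) has_integral p b - p a) {a..b}"
  using x_integral_shift[of a \<tau> b] assms tau by (simp add: p_def)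

text \<open>Between sampling times \<open>e\<close> satisfies \<open>e' = A e\<close>, because \<open>z' = A z + B u\<close> and
  \<open>p' = A p + B u\<close>.\<close>

lemma norm_e:
  assumes "T i \<le> t" "t < T (Suc i)"
  shows "norm (e t) \<le> 2 * exp (2 * \<alpha> * r) * norm (e (T i))"
proof -
  have "norm (e t) \<le> 2 * exp (2 * \<alpha> * (t - T i)) * (norm (e (T i)) + 0 * (t - T i))"
  proof (rule gronwall_bound[where h = "\<lambda>s. A *v e s"])
    show "continuous_on {T i..t} e"
      unfolding e_def using assms
      by (intro continuous_intros p_cont T_nonneg continuous_on_subset[OF z_cont]) auto
  next
    fix s assume s: "s \<in> {T i..t}"
    have "((\<lambda>s. (A + B ** k) *v z s - (A *v p s + B *v u s)) has_integral
        (z s - z (T i)) - (p s - p (T i))) {T i..s}"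
      using s assms T_nonneg by (intro has_integral_diff z_integral p_integral) auto
    then have "((\<lambda>s. A *v e s) has_integral (z s - z (T i)) - (p s - p (T i))) {T i..s}"
      by (rule has_integral_eq[rotated])
        (use T_nonneg[of i] in \<open>simp add: e_def u_future matrix_vector_mult_add_rdistrib
          matrix_vector_mul_assoc matrix_vector_mult_diff_distrib\<close>)
    then show "((\<lambda>s. A *v e s) has_integral e s - e (T i)) {T i..s}"
      by (simp add: e_def algebra_simps)
  qed (use \<alpha> assms in auto)
  also have "\<dots> \<le> 2 * exp (2 * \<alpha> * r) * (norm (e (T i)) + 0 * (t - T i))"
    using assms \<alpha> T_step[of i] by (intro mult_right_mono mult_left_mono) auto
  finally show ?thesis by simp
qed

text \<open>\<open>ode_decay\<close> tolerates only finitely many exceptional times, while x' is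
  known almost everywhere. Between sampling times the input is continuous, so the integral identity
  yields a genuine derivative.\<close>

lemma p_deriv:
  assumes "t > 0" "t \<notin> range T"
  shows "(p has_vector_derivative ((A + B ** k) *v p t + B *v (k *v e t))) (at t)"
proof -
  obtain i where "T i \<le> t" "t < T (Suc i)" using T_locate assms by (metis less_imp_le)
  then have i: "T i < t" "t < T (Suc i)" using assms by (auto simp: less_le)
  \<comment> \<open>A compact interval around t that stops before the next sampling time, where z
    may jump.\<close>
  define d where "d = (t + T (Suc i)) / 2"
  have d: "t < d" "d < T (Suc i)" using i by (auto simp: d_def)
  define h where "h s = A *v p s + B *v (k *v z s)" for s
  have "continuous_on {T i..d} h"
    unfolding h_def using i d T_nonneg
    by (intro continuous_intros linear_continuous_on_compose[OF _ matrix_vector_mul_linear]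
        p_cont continuous_on_subset[OF z_cont]) auto
  then have "((\<lambda>s. integral {T i..s} h) has_vector_derivative h t) (at t within {T i..d})"
    using i d by (intro integral_has_vector_derivative) auto
  moreover have "integral {T i..s} h = p s - p (T i)" if "s \<in> {T i..d}" for s
  proof (rule integral_unique)
    have "((\<lambda>s. A *v p s + B *v u s) has_integral p s - p (T i)) {T i..s}"
      using that T_nonneg by (intro p_integral) auto
    then show "(h has_integral p s - p (T i)) {T i..s}"
      by (rule has_integral_eq[rotated]) (use T_nonneg[of i] in \<open>auto simp: h_def u_future\<close>)
  qed
  ultimately have "((\<lambda>s. p s - p (T i)) has_vector_derivative h t) (at t within {T i..d})"
    using i d by - (rule has_vector_derivative_transform, auto)
  then have "((\<lambda>s. p s - p (T i) + p (T i)) has_vector_derivative h t + 0) (at t within {T i..d})"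
    by (intro has_vector_derivative_add has_vector_derivative_const)
  then have "(p has_vector_derivative h t) (at t within {T i..d})" by simp
  moreover have at: "at t within {T i..d} = at t" using i d by (intro at_within_Icc_at) auto
  moreover have ht: "h t = (A + B ** k) *v p t + B *v (k *v e t)"
    by (simp add: h_def e_def matrix_vector_mult_add_rdistrib matrix_vector_mul_assoc
        matrix_vector_mult_diff_distrib)
  ultimately show ?thesis unfolding at ht by blast
qed

text \<open>Up to time \<tau> only the initial input reaches x, so this is
  \<open>window_bound\<close> at t0 = 0, whatever the feedback does.\<close>

lemma x_initial_window:
  assumes "t \<in> {0..\<tau>}"
  shows "norm (x t) \<le> 2 * exp (2 * \<alpha> * \<tau>) * (1 + \<beta> * \<tau>) * D"
proof -
  have "norm (x (t + 0)) \<le> 2 * exp (2 * \<alpha> * \<tau>) * (norm (x 0) + \<beta> * \<tau> * D)"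
    using assms norm_u_past by (intro window_bound) auto
  also have "\<dots> \<le> 2 * exp (2 * \<alpha> * \<tau>) * (D + \<beta> * \<tau> * D)"
    using norm_x0 by (intro mult_left_mono add_right_mono) (auto simp: x_0)
  finally show ?thesis by (simp add: algebra_simps)
qed

lemma C_nonneg: "C \<ge> 0"
  using \<alpha>(1) \<beta>(1) tau by (simp add: predictor_error_const_def)

end

text \<open>The conditions on \<open>K\<close> and \<open>\<eta>\<close> give \<open>G (|p 0| + \<beta> \<kappa> \<eta> K D) \<le> K D\<close>, the two terms contributing
  one half each; \<open>N_large\<close> makes the error on the next sampling interval at most
  \<open>\<eta> K D exp (- \<sigma> t)\<close>.\<close>

locale decaying_loop = closed_loop +
  fixes \<sigma> G K \<eta> :: real
  assumes \<sigma>: "\<sigma> > 0" and G: "G \<ge> 0" "ode_decay ((*v) (A + B ** k)) UNIV \<sigma> G"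
    and K: "K \<ge> 1" "2 * exp (2 * \<alpha> * \<tau>) * (1 + \<beta> * \<tau>) \<le> K"
      "2 * G * (2 * exp (2 * \<alpha> * \<tau>) * (1 + \<beta> * \<tau>)) \<le> K"
    and \<eta>: "\<eta> > 0" "\<eta> \<le> 1" "2 * G * \<beta> * \<kappa> * \<eta> \<le> 1"
    and N_large: "2 * exp (2 * \<alpha> * r) * exp (\<sigma> * r) * predictor_error_const \<alpha> \<beta> \<tau> *
      ((2 + 2 * \<kappa>) * exp (\<sigma> * \<tau>)) \<le> \<eta> * real N"
begin

section \<open>Closing the loop of exponential bounds\<close>

lemma exp_delay:
  assumes "t - d \<le> s"
  shows "exp (- \<sigma> * s) \<le> exp (\<sigma> * d) * exp (- \<sigma> * t)"
proof -
  have "\<sigma> * (t - d) \<le> \<sigma> * s" using assms \<sigma> by (intro mult_left_mono) auto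
  then show ?thesis by (simp add: algebra_simps flip: exp_add)
qed

lemma p_bound:
  assumes e: "\<And>s. s \<in> {0..<b} \<Longrightarrow> norm (e s) \<le> \<eta> * K * D * exp (- \<sigma> * s)"
    and t: "t \<in> {0..b}"
  shows "norm (p t) \<le> K * D * exp (- \<sigma> * t)"
proof -
  obtain i where i: "b < T i" using T_unbounded by blast
  \<comment> \<open>Besides the sampling times, 0 is excluded because \<open>p_deriv\<close> needs
    positive time, and b because the error bound is assumed only before b. Continuity of p still
    gives the estimate at b.\<close>
  define S where "S = insert 0 (insert b (T ` {..i}))"
  have notin: "s \<notin> range T" if "s \<in> {0..b} - S" for s
  proof
    assume "s \<in> range T"
    then obtain n where n: "s = T n" by blast
    then have "n < i" using that i T_mono by (metis DiffD1 atLeastAtMost_iff order_le_less_trans strict_mono_less)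
    then show False using that n by (simp add: S_def)
  qed
  define F where "F = \<beta> * \<kappa> * (\<eta> * K * D)"
  have "F \<ge> 0" using \<beta> \<kappa> \<eta> K D_nonneg by (simp add: F_def)
  have "norm (p t) \<le> G * (norm (p 0) + F) * exp (- \<sigma> * t)"
  proof (rule ode_decayD[OF G(2) _ _ _ _ \<open>F \<ge> 0\<close> UNIV_I t])
    show "finite S" by (simp add: S_def)
    show "continuous_on {0..b} p" by (rule p_cont) simp
    fix s assume s: "s \<in> {0..b} - S"
    show "(p has_vector_derivative ((A + B ** k) *v p s + B *v (k *v e s))) (at s)"
      using s notin[OF s] by (intro p_deriv) (auto simp: S_def)
    have "norm (B *v (k *v e s)) \<le> \<beta> * (\<kappa> * norm (e s))"
      using \<beta>(1) by (rule order_trans[OF \<beta>(2) mult_left_mono[OF \<kappa>(2) less_imp_le]])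
    also have "\<dots> \<le> \<beta> * (\<kappa> * (\<eta> * K * D * exp (- \<sigma> * s)))"
      using s \<beta>(1) \<kappa>(1) by (intro mult_left_mono e) (auto simp: S_def)
    finally show "norm (B *v (k *v e s)) \<le> F * exp (- \<sigma> * s)"
      by (simp add: F_def mult.assoc)
  qed
  also have "\<dots> \<le> K * D * exp (- \<sigma> * t)"
  proof (rule mult_right_mono)
    define c where "c = 2 * exp (2 * \<alpha> * \<tau>) * (1 + \<beta> * \<tau>)"
    have c: "2 * G * c / 2 \<le> K / 2" using K(3) unfolding c_def by (rule divide_right_mono) simp
    have "norm (p 0) \<le> c * D"
      using x_initial_window[of \<tau>] tau by (simp add: p_def c_def)
    then have "G * (norm (p 0) + F) \<le> G * (c * D + F)"
      using G(1) by (intro mult_left_mono) auto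
    also have "\<dots> = (2 * G * c) / 2 * D + (2 * G * \<beta> * \<kappa> * \<eta>) * (K * D / 2)"
      by (simp add: F_def algebra_simps)
    also have "\<dots> \<le> K / 2 * D + 1 * (K * D / 2)"
      using K(1) D_nonneg \<eta>(3) c by (intro add_mono mult_right_mono) auto
    finally show "G * (norm (p 0) + F) \<le> K * D" by simp
  qed simp
  finally show ?thesis .
qed

text \<open>x is p delayed by \<tau>, which costs exp (\<sigma> \<tau>); before time \<tau> the
  bound on the initial window takes over.\<close>

lemma x_bound:
  assumes e: "\<And>s. s \<in> {0..<t} \<Longrightarrow> norm (e s) \<le> \<eta> * K * D * exp (- \<sigma> * s)" and "0 \<le> t"
  shows "norm (x t) \<le> exp (\<sigma> * \<tau>) * (K * D * exp (- \<sigma> * t))"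
proof (cases "\<tau> \<le> t")
  case True
  have "norm (x t) \<le> K * D * exp (- \<sigma> * (t - \<tau>))"
    using p_bound[of t "t - \<tau>"] e True tau by (simp add: p_def)
  also have "\<dots> \<le> K * D * (exp (\<sigma> * \<tau>) * exp (- \<sigma> * t))"
    using K D_nonneg by (intro mult_left_mono exp_delay) auto
  finally show ?thesis by (simp add: mult_ac)
next
  case False
  then have "norm (x t) \<le> 2 * exp (2 * \<alpha> * \<tau>) * (1 + \<beta> * \<tau>) * D"
    using \<open>0 \<le> t\<close> by (intro x_initial_window) auto
  also have "\<dots> \<le> K * D * exp (- \<sigma> * 0)"
    using K D_nonneg by (simp add: mult_right_mono)
  also have "\<dots> \<le> K * D * (exp (\<sigma> * \<tau>) * exp (- \<sigma> * t))"
    using K D_nonneg False by (intro mult_left_mono exp_delay) auto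
  finally show ?thesis by (simp add: mult_ac)
qed

text \<open>In 1 + 2 \<kappa>, the 1 pays for the initial input and 2 \<kappa> for the feedback
  \<open>k *v (p s + e s)\<close>: as \<eta> \<le> 1, the error is covered by the same bound as
  p.\<close>

lemma u_bound:
  assumes e: "\<And>s. s \<in> {0..<t} \<Longrightarrow> norm (e s) \<le> \<eta> * K * D * exp (- \<sigma> * s)"
    and "0 \<le> t" and s: "s \<in> {t - \<tau>..<t}"
  shows "norm (u s) \<le> (1 + 2 * \<kappa>) * exp (\<sigma> * \<tau>) * (K * D * exp (- \<sigma> * t))"
proof -
  have KD: "0 \<le> K * D" using K D_nonneg by simp
  have delay: "K * D * exp (- \<sigma> * s') \<le> exp (\<sigma> * \<tau>) * (K * D * exp (- \<sigma> * t))" if "t - \<tau> \<le> s'" for s'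
    using mult_left_mono[OF exp_delay[OF that] KD] by (simp add: mult_ac)
  have "norm (u s) \<le> (1 + 2 * \<kappa>) * (exp (\<sigma> * \<tau>) * (K * D * exp (- \<sigma> * t)))"
  proof (cases "s < 0")
    case True
    then have "norm (u s) \<le> 1 * D" using norm_u_past[of s] s \<open>0 \<le> t\<close> by simp
    also have "\<dots> \<le> K * D * exp (- \<sigma> * 0)" using mult_right_mono[OF K(1) D_nonneg] by simp
    also have "\<dots> \<le> 1 * (exp (\<sigma> * \<tau>) * (K * D * exp (- \<sigma> * t)))"
      using s True unfolding mult_1 by (intro delay) auto
    also have "\<dots> \<le> (1 + 2 * \<kappa>) * (exp (\<sigma> * \<tau>) * (K * D * exp (- \<sigma> * t)))"
      using \<kappa> KD by (intro mult_right_mono) auto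
    finally show ?thesis .
  next
    case False
    have "u s = k *v (p s + e s)" using False by (simp add: u_future e_def)
    then have "norm (u s) \<le> \<kappa> * norm (p s + e s)" using \<kappa>(2) by simp
    also have "\<dots> \<le> \<kappa> * (K * D * exp (- \<sigma> * s) + \<eta> * K * D * exp (- \<sigma> * s))"
      using \<kappa>(1) s False p_bound[OF e, of t s] e[of s]
      by (intro mult_left_mono norm_triangle_le add_mono) auto
    also have "\<dots> \<le> \<kappa> * (K * D * exp (- \<sigma> * s) + 1 * (K * D * exp (- \<sigma> * s)))"
      using \<kappa>(1) mult_right_mono[OF \<eta>(2) mult_nonneg_nonneg[OF KD exp_ge_zero]]
      by (intro mult_left_mono add_left_mono) (simp_all only: mult.assoc less_imp_le)
    also have "\<dots> = 2 * \<kappa> * (K * D * exp (- \<sigma> * s))" by simp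
    also have "\<dots> \<le> 2 * \<kappa> * (exp (\<sigma> * \<tau>) * (K * D * exp (- \<sigma> * t)))"
      using \<kappa>(1) s by (intro mult_left_mono delay) auto
    also have "\<dots> \<le> (1 + 2 * \<kappa>) * (exp (\<sigma> * \<tau>) * (K * D * exp (- \<sigma> * t)))"
      using KD by (intro mult_right_mono) auto
    finally show ?thesis .
  qed
  then show ?thesis by (simp add: mult.assoc)
qed

text \<open>The sample at T i sees only quantities governed by the error before T i. The factor 2 +
  2 \<kappa> adds the bounds on x and u, 2 exp (2 \<alpha> r) is the growth of e until t, exp
  (\<sigma> r) the decay lost meanwhile; \<open>N_large\<close> brings the product back to
  \<eta>.\<close>

lemma e_bound_interval:
  assumes e: "\<And>s. s \<in> {0..<T i} \<Longrightarrow> norm (e s) \<le> \<eta> * K * D * exp (- \<sigma> * s)"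
    and t: "T i \<le> t" "t < T (Suc i)"
  shows "norm (e t) \<le> \<eta> * K * D * exp (- \<sigma> * t)"
proof -
  define W where "W = K * D * exp (- \<sigma> * T i)"
  have W: "W \<ge> 0" using K D_nonneg by (simp add: W_def)
  have "norm (e (T i)) \<le> C / real N * (norm (x (T i)) + (1 + 2 * \<kappa>) * exp (\<sigma> * \<tau>) * W)"
    unfolding W_def by (rule norm_e_sample[OF u_bound[OF e T_nonneg]])
  also have "\<dots> \<le> C / real N * (exp (\<sigma> * \<tau>) * W + (1 + 2 * \<kappa>) * exp (\<sigma> * \<tau>) * W)"
    using C_nonneg x_bound[OF e T_nonneg] by (intro mult_left_mono add_right_mono) (auto simp: W_def)
  also have "\<dots> = C / real N * ((2 + 2 * \<kappa>) * exp (\<sigma> * \<tau>)) * W" by (simp add: algebra_simps)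
  finally have "norm (e t) \<le> 2 * exp (2 * \<alpha> * r) * (C / real N * ((2 + 2 * \<kappa>) * exp (\<sigma> * \<tau>)) * W)"
    by (intro order_trans[OF norm_e[OF t] mult_left_mono]) simp_all
  also have "\<dots> \<le> 2 * exp (2 * \<alpha> * r) * (C / real N * ((2 + 2 * \<kappa>) * exp (\<sigma> * \<tau>)) *
      (exp (\<sigma> * r) * (K * D * exp (- \<sigma> * t))))"
  proof -
    have "exp (- \<sigma> * T i) \<le> exp (\<sigma> * r) * exp (- \<sigma> * t)"
      using t T_step[of i] by (intro exp_delay) auto
    then have "W \<le> exp (\<sigma> * r) * (K * D * exp (- \<sigma> * t))"
      using mult_left_mono[of "exp (- \<sigma> * T i)" "exp (\<sigma> * r) * exp (- \<sigma> * t)" "K * D"] K(1) D_nonneg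
      by (simp add: W_def mult.left_commute)
    then show ?thesis using C_nonneg \<kappa>(1) by (intro mult_left_mono) auto
  qed
  also have "\<dots> = (2 * exp (2 * \<alpha> * r) * exp (\<sigma> * r) * C * ((2 + 2 * \<kappa>) * exp (\<sigma> * \<tau>))) / real N
      * (K * D * exp (- \<sigma> * t))" by simp
  also have "\<dots> \<le> \<eta> * (K * D * exp (- \<sigma> * t))"
    using N_large N K D_nonneg by (intro mult_right_mono) (auto simp: divide_le_eq)
  finally show ?thesis by (simp add: mult.assoc)
qed

lemma e_bound:
  assumes "0 \<le> t"
  shows "norm (e t) \<le> \<eta> * K * D * exp (- \<sigma> * t)"
proof -
  have "\<forall>s\<in>{0..<T i}. norm (e s) \<le> \<eta> * K * D * exp (- \<sigma> * s)" for i
  proof (induction i)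
    case (Suc i)
    then show ?case using e_bound_interval[of i] by (metis atLeastLessThan_iff not_less)
  qed (simp add: T_0)
  moreover obtain i where "t < T i" using T_unbounded by blast
  ultimately show ?thesis using assms by auto
qed

lemma state_bound:
  assumes "0 \<le> t"
  shows "bdd_above ((\<lambda>s. norm (u s)) ` {t - \<tau>..<t})"
    and "norm (x t) + (SUP s\<in>{t - \<tau>..<t}. norm (u s)) \<le> (2 + 2 * \<kappa>) * exp (\<sigma> * \<tau>) * K * exp (- \<sigma> * t) * D"
proof -
  have u: "norm (u s) \<le> (1 + 2 * \<kappa>) * exp (\<sigma> * \<tau>) * (K * D * exp (- \<sigma> * t))" if "s \<in> {t - \<tau>..<t}" for s
    using u_bound[OF _ assms that] e_bound by simp
  then show "bdd_above ((\<lambda>s. norm (u s)) ` {t - \<tau>..<t})" by (intro bdd_aboveI2)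
  have "(SUP s\<in>{t - \<tau>..<t}. norm (u s)) \<le> (1 + 2 * \<kappa>) * exp (\<sigma> * \<tau>) * (K * D * exp (- \<sigma> * t))"
    using tau u by (intro cSUP_least) auto
  moreover have "norm (x t) \<le> exp (\<sigma> * \<tau>) * (K * D * exp (- \<sigma> * t))"
    using x_bound[OF _ assms] e_bound by simp
  ultimately have "norm (x t) + (SUP s\<in>{t - \<tau>..<t}. norm (u s)) \<le>
    exp (\<sigma> * \<tau>) * (K * D * exp (- \<sigma> * t)) + (1 + 2 * \<kappa>) * exp (\<sigma> * \<tau>) * (K * D * exp (- \<sigma> * t))"
    by (intro add_mono)
  also have "\<dots> = (2 + 2 * \<kappa>) * exp (\<sigma> * \<tau>) * K * exp (- \<sigma> * t) * D" by (simp add: algebra_simps)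
  finally show "norm (x t) + (SUP s\<in>{t - \<tau>..<t}. norm (u s)) \<le> (2 + 2 * \<kappa>) * exp (\<sigma> * \<tau>) * K * exp (- \<sigma> * t) * D" .
qed

end

theorem theorem1p2:
  fixes A :: "real^'n^'n" and B :: "real^'m^'n" and k :: "real^'n^'m" and \<tau> :: real
  assumes "\<tau> > 0"
    and "hurwitz (A + B ** k)"
  shows "\<forall>r>0. \<exists>Nstar::nat. Nstar \<ge> 1 \<and> (\<forall>N\<ge>Nstar.
           \<exists>Q \<sigma>. Q > 0 \<and> \<sigma> > 0 \<and>
             (\<forall>T. time_partition T \<and> mesh_le T r \<longrightarrow>
               (\<forall>x0 u0 x z u.
                  L_infinity_on {-\<tau>..<0} u0 \<and> closed_loop_solution A B k \<tau> N T x0 u0 x z u \<longrightarrow>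
                  (\<forall>t\<ge>0.
                     bdd_above ((\<lambda>s. norm (u s)) ` {t - \<tau>..<t}) \<and>
                     norm (x t) + (SUP s\<in>{t - \<tau>..<t}. norm (u s))
                       \<le> Q * exp (- \<sigma> * t) * (norm x0 + (SUP s\<in>{-\<tau>..<0}. norm (u0 s)))))))"
proof (intro allI impI)
  fix r :: real
  assume "r > 0"
  obtain \<alpha> where \<alpha>: "\<alpha> > 0" "\<And>v. norm (A *v v) \<le> \<alpha> * norm v" using matrix_norm_bound by blast
  obtain \<beta> where \<beta>: "\<beta> > 0" "\<And>v. norm (B *v v) \<le> \<beta> * norm v" using matrix_norm_bound by blast
  obtain \<kappa> where \<kappa>: "\<kappa> > 0" "\<And>v. norm (k *v v) \<le> \<kappa> * norm v" using matrix_norm_bound by blast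
  obtain \<sigma> G where \<sigma>: "\<sigma> > 0" and G: "G \<ge> 0" "ode_decay ((*v) (A + B ** k)) UNIV \<sigma> G"
    using hurwitz_ode_decay[OF assms(2)] by blast
  \<comment> \<open>c D bounds x on the initial window, hence also p 0; K then exceeds 1, c and 2 G
    c at once, being their sum.\<close>
  define c where "c = 2 * exp (2 * \<alpha> * \<tau>) * (1 + \<beta> * \<tau>)"
  have "c \<ge> 0" using \<beta> assms(1) by (simp add: c_def)
  define K where "K = 1 + c + 2 * G * c"
  have K: "K \<ge> 1" "c \<le> K" "2 * G * c \<le> K" using \<open>c \<ge> 0\<close> G(1) by (simp_all add: K_def)
  define \<eta> where "\<eta> = 1 / (1 + 2 * G * \<beta> * \<kappa>)"
  have pos: "0 < 1 + 2 * G * \<beta> * \<kappa>" using G(1) \<beta>(1) \<kappa>(1) by (simp add: add_pos_nonneg)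
  have \<eta>: "\<eta> > 0" "\<eta> \<le> 1" "2 * G * \<beta> * \<kappa> * \<eta> \<le> 1"
    using pos G(1) \<beta>(1) \<kappa>(1) by (simp_all add: \<eta>_def divide_le_eq)
  define L where "L = 2 * exp (2 * \<alpha> * r) * exp (\<sigma> * r) * predictor_error_const \<alpha> \<beta> \<tau> *
      ((2 + 2 * \<kappa>) * exp (\<sigma> * \<tau>))"
  \<comment> \<open>The least choice that guarantees both N \<ge> 1 and L \<le> \<eta> N, the latter
    being \<open>N_large\<close>.\<close>
  define Nstar where "Nstar = max 1 (nat \<lceil>L / \<eta>\<rceil>)"
  define Q where "Q = (2 + 2 * \<kappa>) * exp (\<sigma> * \<tau>) * K"
  have "Q > 0" using \<kappa>(1) K(1) by (simp add: Q_def)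
  show "\<exists>Nstar::nat. Nstar \<ge> 1 \<and> (\<forall>N\<ge>Nstar.
           \<exists>Q \<sigma>. Q > 0 \<and> \<sigma> > 0 \<and>
             (\<forall>T. time_partition T \<and> mesh_le T r \<longrightarrow>
               (\<forall>x0 u0 x z u.
                  L_infinity_on {-\<tau>..<0} u0 \<and> closed_loop_solution A B k \<tau> N T x0 u0 x z u \<longrightarrow>
                  (\<forall>t\<ge>0.
                     bdd_above ((\<lambda>s. norm (u s)) ` {t - \<tau>..<t}) \<and>
                     norm (x t) + (SUP s\<in>{t - \<tau>..<t}. norm (u s))
                       \<le> Q * exp (- \<sigma> * t) * (norm x0 + (SUP s\<in>{-\<tau>..<0}. norm (u0 s)))))))"
  proof (rule exI[of _ Nstar], intro conjI allI impI)
    show "Nstar \<ge> 1" by (simp add: Nstar_def)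
    fix N assume "Nstar \<le> N"
    then have N: "N \<ge> 1" and "L / \<eta> \<le> real N" by (auto simp: Nstar_def ceiling_le_iff nat_le_iff)
    then have L: "L \<le> \<eta> * real N" using \<eta>(1) by (simp add: pos_divide_le_eq mult.commute)
    show "\<exists>Q \<sigma>. Q > 0 \<and> \<sigma> > 0 \<and>
             (\<forall>T. time_partition T \<and> mesh_le T r \<longrightarrow>
               (\<forall>x0 u0 x z u.
                  L_infinity_on {-\<tau>..<0} u0 \<and> closed_loop_solution A B k \<tau> N T x0 u0 x z u \<longrightarrow>
                  (\<forall>t\<ge>0.
                     bdd_above ((\<lambda>s. norm (u s)) ` {t - \<tau>..<t}) \<and>
                     norm (x t) + (SUP s\<in>{t - \<tau>..<t}. norm (u s))
                       \<le> Q * exp (- \<sigma> * t) * (norm x0 + (SUP s\<in>{-\<tau>..<0}. norm (u0 s))))))"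
    proof (rule exI[of _ Q], rule exI[of _ \<sigma>], intro conjI allI impI \<open>Q > 0\<close> \<sigma>)
      fix T x0 u0 x z and u :: "real \<Rightarrow> real^'m" and t :: real
      assume T: "time_partition T \<and> mesh_le T r"
        and sol: "L_infinity_on {-\<tau>..<0} u0 \<and> closed_loop_solution A B k \<tau> N T x0 u0 x z u"
        and "t \<ge> 0"
      interpret decaying_loop A B k \<tau> N T r x0 u0 x z u \<alpha> \<beta> \<kappa> \<sigma> G K \<eta>
        by unfold_locales (use assms N T sol \<alpha> \<beta> \<kappa> \<sigma> G K \<eta> L in \<open>auto simp: c_def L_def\<close>)
      show "bdd_above ((\<lambda>s. norm (u s)) ` {t - \<tau>..<t})"
        using state_bound(1) \<open>t \<ge> 0\<close> .
      show "norm (x t) + (SUP s\<in>{t - \<tau>..<t}. norm (u s))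
          \<le> Q * exp (- \<sigma> * t) * (norm x0 + (SUP s\<in>{-\<tau>..<0}. norm (u0 s)))"
        using state_bound(2)[OF \<open>t \<ge> 0\<close>] by (simp only: Q_def D_def)
    qed
  qed
qed

end
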